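(* Let $\mathcal V$ be an integral commutative quantale. For a $\mathcal V\text{-}\mathsf{cat}$-functor $G:\mathcal V\text{-}\mathsf{cat}\to\mathcal V\text{-}\mathsf{cat}$ the following are equivalent: (1) There exists a functor $T:\mathsf{Set}\to\mathsf{Set}$ such that $G\cong\mathrm{Lan}_D(DT)$, that is, $G$ is the $\mathcal V\text{-}\mathsf{cat}$-ification $T_{\mathcal V}$ of $T$. (2) $G$ preserves the colimits of all diagrams $(N,DF_{\mathcal X})$, for $\mathcal X$ a small $\mathcal V$-category, and $G$ preserves discrete $\mathcal V$-categories.
   Context: $\mathcal V=(\mathcal V_o,\otimes,e,[-,-])$ is a commutative quantale: a complete lattice with a commutative, associative, monotone operation $\otimes$ with unit $e$, such that each $-\otimes r$ has a right adjoint $[r,-]$; it is assumed non-trivial ($e\neq\bot$), and it is integral if $e=\top$. A (small) $\mathcal V$-category $\mathcal X$ is a set of objects together with elements $\mathcal X(x',x)\in\mathcal V_o$ satisfying $e\le\mathcal X(x,x)$ and $\mathcal X(x',x)\otimes\mathcal X(x'',x')\le\mathcal X(x'',x)$; a $\mathcal V$-functor $f:\mathcal X\to\mathcal Y$ is a map on objects with $\mathcal X(x',x)\le\mathcal Y(fx',fx)$. A $\mathcal V$-category is discrete if $\mathcal X(x',x)=e$ for $x'=x$ and $\bot$ otherwise. $\mathcal V\text{-}\mathsf{cat}$ is the symmetric monoidal closed category of small $\mathcal V$-categories and $\mathcal V$-functors, with $(\mathcal X\otimes\mathcal Y)((x',y'),(x,y))=\mathcal X(x',x)\otimes\mathcal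 Y(y',y)$, unit $\mathbb 1$ (one object $0$ with $\mathbb 1(0,0)=e$), and internal hom $[\mathcal Y,\mathcal Z]=\mathcal V\text{-}\mathsf{cat}(\mathcal Y,\mathcal Z)$ of $\mathcal V$-functors with $[\mathcal Y,\mathcal Z](f,g)=\bigwedge_y\mathcal Z(fy,gy)$; it is enriched over itself. $\mathsf{Set}$ is regarded as a $\mathcal V\text{-}\mathsf{cat}$-category whose homs are the discrete $\mathcal V$-categories on the sets of functions; $D:\mathsf{Set}\to\mathcal V\text{-}\mathsf{cat}$ sends a set to the discrete $\mathcal V$-category on it. The enriched left Kan extension of $H:\mathsf{Set}\to\mathcal V\text{-}\mathsf{cat}$ along $D$ is $(\mathrm{Lan}_DH)\mathcal X\cong\mathcal V\text{-}\mathsf{cat}(D-,\mathcal X)*H$ (weighted colimit); the $\mathcal V\text{-}\mathsf{cat}$-ification of $T:\mathsf{Set}\to\mathsf{Set}$ is $T_{\mathcal V}=\mathrm{Lan}_D(DT)$. $\mathbb N$ is the free $\mathcal V\text{-}\mathsf{cat}$-category on the ordinary category with objects all $r\in\mathcal V_o$ and an extra object $\mathsf o$, and non-identity arrows $\delta^r_0,\delta^r_1:r\to\mathsf o$. The weight $N:\mathbb N^{op}\to\mathcal V\text{-}\mathsf{cat}$ sends $\mathsf o$ to $\mathbb 1$ and $r$ to $\mathbb 2_r$, the $\mathcal V$-category with objects $0,1$, self-distances $e$, $\mathbb 2_r(0,1)=r$, $\mathbb 2_r(1,0)=\bot$; $N\delta^r_i$ picks $i$. $F_{\mathcal X}:\mathbb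 N\to\mathsf{Set}$ sends $\mathsf o$ to the set $X_{\mathsf o}$ of objects of $\mathcal X$, $r$ to $X_r=\{(x',x)\mid r\le\mathcal X(x',x)\}$, and $\delta^r_0,\delta^r_1$ to the first and second projections. The colimit of $(N,DF_{\mathcal X})$ is the weighted colimit $N*DF_{\mathcal X}$ in $\mathcal V\text{-}\mathsf{cat}$. *)

theory Defs
  imports "HOL-Library.FuncSet"
begin

unbundle cardinal_syntax

section \<open>Commutative quantales and categories enriched in them\<close>

class comm_quantale = complete_lattice + comm_monoid_mult +
  fixes residual :: "'a \<Rightarrow> 'a \<Rightarrow> 'a"
  assumes residuation: "x * r \<le> s \<longleftrightarrow> x \<le> residual r s"
    and unit_neq_bot: "1 \<noteq> bot"

text \<open>
  \<open>dst X x' x\<close> is the element \<open>X(x', x)\<close> of the quantale. Distances outside the set of objects are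
  normalised to \<open>bot\<close>, so that equality of records is equality of enriched categories.
\<close>

record ('o, 'v) vcat =
  obj :: "'o set"
  dst :: "'o \<Rightarrow> 'o \<Rightarrow> 'v"

definition mk_vcat :: "'o set \<Rightarrow> ('o \<Rightarrow> 'o \<Rightarrow> 'v) \<Rightarrow> ('o, 'v::comm_quantale) vcat" where
  "mk_vcat A d = \<lparr>obj = A, dst = (\<lambda>x' x. if x' \<in> A \<and> x \<in> A then d x' x else bot)\<rparr>"

definition is_vcat :: "('o, 'v::comm_quantale) vcat \<Rightarrow> bool" where
  "is_vcat X \<longleftrightarrow>
     (\<forall>x\<in>obj X. 1 \<le> dst X x x) \<and>
     (\<forall>x''\<in>obj X. \<forall>x'\<in>obj X. \<forall>x\<in>obj X. dst X x' x * dst X x'' x' \<le> dst X x'' x) \<and>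
     (\<forall>x' x. x' \<notin> obj X \<or> x \<notin> obj X \<longrightarrow> dst X x' x = bot)"

definition is_vfunctor ::
    "('o, 'v::comm_quantale) vcat \<Rightarrow> ('p, 'v) vcat \<Rightarrow> ('o \<Rightarrow> 'p) \<Rightarrow> bool" where
  "is_vfunctor X Y f \<longleftrightarrow>
     f \<in> obj X \<rightarrow> obj Y \<and>
     (\<forall>x'\<in>obj X. \<forall>x\<in>obj X. dst X x' x \<le> dst Y (f x') (f x))"

definition vcat_iso ::
    "('o, 'v::comm_quantale) vcat \<Rightarrow> ('p, 'v) vcat \<Rightarrow> ('o \<Rightarrow> 'p) \<Rightarrow> bool" where
  "vcat_iso X Y f \<longleftrightarrow> is_vfunctor X Y f \<and>
     (\<exists>g. is_vfunctor Y X g \<and> (\<forall>x\<in>obj X. g (f x) = x) \<and> (\<forall>y\<in>obj Y. f (g y) = y))"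

definition is_discrete :: "('o, 'v::comm_quantale) vcat \<Rightarrow> bool" where
  "is_discrete X \<longleftrightarrow>
     (\<forall>x'\<in>obj X. \<forall>x\<in>obj X. dst X x' x = (if x' = x then 1 else bot))"

definition discrete_vcat :: "'o set \<Rightarrow> ('o, 'v::comm_quantale) vcat" where
  "discrete_vcat A = mk_vcat A (\<lambda>x' x. if x' = x then 1 else bot)"

definition unit_vcat :: "(nat, 'v::comm_quantale) vcat" where
  "unit_vcat = mk_vcat {0} (\<lambda>_ _. 1)"

definition two_vcat :: "'v \<Rightarrow> (nat, 'v::comm_quantale) vcat" where
  "two_vcat r = mk_vcat {0, 1} (\<lambda>i j. if i = j then 1 else if i = 0 then r else bot)"

definition tensor_vcat ::
    "('o, 'v::comm_quantale) vcat \<Rightarrow> ('p, 'v) vcat \<Rightarrow> ('o \<times> 'p, 'v) vcat" where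
  "tensor_vcat X Y = mk_vcat (obj X \<times> obj Y)
     (\<lambda>(x', y') (x, y). dst X x' x * dst Y y' y)"

text \<open>Objects of the internal hom are extensional maps, so that each functor occurs once.\<close>

definition ihom ::
    "('o, 'v::comm_quantale) vcat \<Rightarrow> ('p, 'v) vcat \<Rightarrow> ('o \<Rightarrow> 'p, 'v) vcat" where
  "ihom Y Z = mk_vcat {f \<in> extensional (obj Y). is_vfunctor Y Z f}
     (\<lambda>f g. INF y\<in>obj Y. dst Z (f y) (g y))"


section \<open>Ordinary categories and categories enriched in \<open>V-cat\<close>\<close>

record ('c, 'm) cat =
  Ob :: "'c set"
  Ar :: "'c \<Rightarrow> 'c \<Rightarrow> 'm set"
  cmp :: "'c \<Rightarrow> 'c \<Rightarrow> 'c \<Rightarrow> 'm \<Rightarrow> 'm \<Rightarrow> 'm"  \<comment> \<open>\<open>cmp a b c g f\<close> is \<open>g \<circ> f : a \<rightarrow> b \<rightarrow> c\<close>\<close>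
  idn :: "'c \<Rightarrow> 'm"

definition is_cat :: "('c, 'm) cat \<Rightarrow> bool" where
  "is_cat C \<longleftrightarrow>
     (\<forall>a\<in>Ob C. idn C a \<in> Ar C a a) \<and>
     (\<forall>a\<in>Ob C. \<forall>b\<in>Ob C. \<forall>c\<in>Ob C. \<forall>f\<in>Ar C a b. \<forall>g\<in>Ar C b c. cmp C a b c g f \<in> Ar C a c) \<and>
     (\<forall>a\<in>Ob C. \<forall>b\<in>Ob C. \<forall>f\<in>Ar C a b.
        cmp C a a b f (idn C a) = f \<and> cmp C a b b (idn C b) f = f) \<and>
     (\<forall>a\<in>Ob C. \<forall>b\<in>Ob C. \<forall>c\<in>Ob C. \<forall>d\<in>Ob C. \<forall>f\<in>Ar C a b. \<forall>g\<in>Ar C b c. \<forall>h\<in>Ar C c d.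
        cmp C a b d (cmp C b c d h g) f = cmp C a c d h (cmp C a b c g f))"

record ('c, 'm, 'v) ecat =
  Obj :: "'c set"
  Hom :: "'c \<Rightarrow> 'c \<Rightarrow> ('m, 'v) vcat"
  Comp :: "'c \<Rightarrow> 'c \<Rightarrow> 'c \<Rightarrow> 'm \<Rightarrow> 'm \<Rightarrow> 'm"
  Id :: "'c \<Rightarrow> 'm"

text \<open>
  The identity of \<open>a\<close> is a functor from the unit enriched category to \<open>Hom a a\<close>,
  which amounts to an object of \<open>Hom a a\<close>.
\<close>

definition is_ecat :: "('c, 'm, 'v::comm_quantale) ecat \<Rightarrow> bool" where
  "is_ecat K \<longleftrightarrow>
     (\<forall>a\<in>Obj K. \<forall>b\<in>Obj K. is_vcat (Hom K a b)) \<and>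
     (\<forall>a\<in>Obj K. Id K a \<in> obj (Hom K a a)) \<and>
     (\<forall>a\<in>Obj K. \<forall>b\<in>Obj K. \<forall>c\<in>Obj K.
        is_vfunctor (tensor_vcat (Hom K b c) (Hom K a b)) (Hom K a c)
          (\<lambda>(g, f). Comp K a b c g f)) \<and>
     (\<forall>a\<in>Obj K. \<forall>b\<in>Obj K. \<forall>f\<in>obj (Hom K a b).
        Comp K a a b f (Id K a) = f \<and> Comp K a b b (Id K b) f = f) \<and>
     (\<forall>a\<in>Obj K. \<forall>b\<in>Obj K. \<forall>c\<in>Obj K. \<forall>d\<in>Obj K.
        \<forall>f\<in>obj (Hom K a b). \<forall>g\<in>obj (Hom K b c). \<forall>h\<in>obj (Hom K c d).
        Comp K a b d (Comp K b c d h g) f = Comp K a c d h (Comp K a b c g f))"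

definition op_ecat :: "('c, 'm, 'v) ecat \<Rightarrow> ('c, 'm, 'v) ecat" where
  "op_ecat K = \<lparr>Obj = Obj K, Hom = (\<lambda>a b. Hom K b a),
     Comp = (\<lambda>a b c g f. Comp K c b a f g), Id = Id K\<rparr>"

definition free_ecat :: "('c, 'm) cat \<Rightarrow> ('c, 'm, 'v::comm_quantale) ecat" where
  "free_ecat C = \<lparr>Obj = Ob C, Hom = (\<lambda>a b. discrete_vcat (Ar C a b)), Comp = cmp C, Id = idn C\<rparr>"

text \<open>
  One record of functor data serves for ordinary and for enriched functors: an ordinary functor,
  read between the free enriched categories, is an enriched functor with the same data.
\<close>

record ('c, 'm, 'd, 'n) fctr =
  fobj :: "'c \<Rightarrow> 'd"
  farr :: "'c \<Rightarrow> 'c \<Rightarrow> 'm \<Rightarrow> 'n"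

definition functor_comp :: "('d, 'n, 'e, 'k) fctr \<Rightarrow> ('c, 'm, 'd, 'n) fctr \<Rightarrow> ('c, 'm, 'e, 'k) fctr" where
  "functor_comp G F = \<lparr>fobj = (\<lambda>a. fobj G (fobj F a)),
     farr = (\<lambda>a b k. farr G (fobj F a) (fobj F b) (farr F a b k))\<rparr>"

definition is_functor :: "('c, 'm) cat \<Rightarrow> ('d, 'n) cat \<Rightarrow> ('c, 'm, 'd, 'n) fctr \<Rightarrow> bool" where
  "is_functor C D F \<longleftrightarrow>
     (\<forall>a\<in>Ob C. fobj F a \<in> Ob D) \<and>
     (\<forall>a\<in>Ob C. \<forall>b\<in>Ob C. \<forall>f\<in>Ar C a b. farr F a b f \<in> Ar D (fobj F a) (fobj F b)) \<and>
     (\<forall>a\<in>Ob C. farr F a a (idn C a) = idn D (fobj F a)) \<and>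
     (\<forall>a\<in>Ob C. \<forall>b\<in>Ob C. \<forall>c\<in>Ob C. \<forall>f\<in>Ar C a b. \<forall>g\<in>Ar C b c.
        farr F a c (cmp C a b c g f) =
          cmp D (fobj F a) (fobj F b) (fobj F c) (farr F b c g) (farr F a b f))"

definition is_efunctor ::
    "('c, 'm, 'v::comm_quantale) ecat \<Rightarrow> ('d, 'n, 'v) ecat \<Rightarrow> ('c, 'm, 'd, 'n) fctr \<Rightarrow> bool" where
  "is_efunctor K L F \<longleftrightarrow>
     (\<forall>a\<in>Obj K. fobj F a \<in> Obj L) \<and>
     (\<forall>a\<in>Obj K. \<forall>b\<in>Obj K.
        is_vfunctor (Hom K a b) (Hom L (fobj F a) (fobj F b)) (farr F a b)) \<and>
     (\<forall>a\<in>Obj K. farr F a a (Id K a) = Id L (fobj F a)) \<and>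
     (\<forall>a\<in>Obj K. \<forall>b\<in>Obj K. \<forall>c\<in>Obj K. \<forall>f\<in>obj (Hom K a b). \<forall>g\<in>obj (Hom K b c).
        farr F a c (Comp K a b c g f) =
          Comp L (fobj F a) (fobj F b) (fobj F c) (farr F b c g) (farr F a b f))"

definition is_iso_in :: "('c, 'm, 'v) ecat \<Rightarrow> 'c \<Rightarrow> 'c \<Rightarrow> 'm \<Rightarrow> bool" where
  "is_iso_in K a b f \<longleftrightarrow> f \<in> obj (Hom K a b) \<and>
     (\<exists>g\<in>obj (Hom K b a). Comp K a b a g f = Id K a \<and> Comp K b a b f g = Id K b)"

text \<open>
  Naturality in the enriched sense is an equality of functors out of \<open>Hom K a b\<close>, and such functors
  are determined by their values on objects.
\<close>

definition efunctors_iso ::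
    "('c, 'm, 'v) ecat \<Rightarrow> ('d, 'n, 'v) ecat \<Rightarrow>
     ('c, 'm, 'd, 'n) fctr \<Rightarrow> ('c, 'm, 'd, 'n) fctr \<Rightarrow> bool" where
  "efunctors_iso K L F G \<longleftrightarrow> (\<exists>\<alpha>.
     (\<forall>a\<in>Obj K. is_iso_in L (fobj F a) (fobj G a) (\<alpha> a)) \<and>
     (\<forall>a\<in>Obj K. \<forall>b\<in>Obj K. \<forall>f\<in>obj (Hom K a b).
        Comp L (fobj F a) (fobj F b) (fobj G b) (\<alpha> b) (farr F a b f) =
        Comp L (fobj F a) (fobj G a) (fobj G b) (farr G a b f) (\<alpha> a)))"


section \<open>The categories \<open>Set\<close> and \<open>V-cat\<close>\<close>

text \<open>
  Smallness is relative to the type \<open>'u\<close>: with \<open>\<kappa>\<close> the cardinality of \<open>'u\<close>, the small sets are the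
  subsets of \<open>'u\<close> with fewer than \<open>\<kappa>\<close> elements. If \<open>\<kappa>\<close> is inaccessible, the categories below are
  equivalent to those of all sets, respectively all enriched categories, in the Grothendieck
  universe of rank \<open>\<kappa>\<close>.
\<close>

definition small_sets :: "'u set set" where
  "small_sets = {A. |A| <o |UNIV :: 'u set| }"

definition SET :: "('u set, 'u \<Rightarrow> 'u) cat" where
  "SET = \<lparr>Ob = small_sets, Ar = (\<lambda>A B. A \<rightarrow>\<^sub>E B),
     cmp = (\<lambda>A B C g f. compose A g f), idn = (\<lambda>A. \<lambda>x\<in>A. x)\<rparr>"

text \<open>
  The self-enriched category of enriched categories whose set of objects lies in \<open>U\<close>. With
  \<open>U = UNIV\<close> it is the codomain of weights, whose values need not have objects in \<open>'u\<close>.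
\<close>

definition VCAT_of :: "'o set set \<Rightarrow> (('o, 'v::comm_quantale) vcat, 'o \<Rightarrow> 'o, 'v) ecat" where
  "VCAT_of U = \<lparr>Obj = {X. is_vcat X \<and> obj X \<in> U}, Hom = ihom,
     Comp = (\<lambda>X Y Z g f. compose (obj X) g f), Id = (\<lambda>X. \<lambda>x\<in>obj X. x)\<rparr>"

abbreviation VCAT :: "(('u, 'v::comm_quantale) vcat, 'u \<Rightarrow> 'u, 'v) ecat" where
  "VCAT \<equiv> VCAT_of small_sets"

abbreviation SETv :: "('u set, 'u \<Rightarrow> 'u, 'v::comm_quantale) ecat" where
  "SETv \<equiv> free_ecat SET"

definition Dfun :: "('u set, 'u \<Rightarrow> 'u, ('u, 'v::comm_quantale) vcat, 'u \<Rightarrow> 'u) fctr" where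
  "Dfun = \<lparr>fobj = discrete_vcat, farr = (\<lambda>A B f. f)\<rparr>"


section \<open>Weighted colimits and left Kan extensions\<close>

text \<open>
  The enriched category \<open>[K, V-cat](W, W')\<close> of natural transformations between functors from \<open>K\<close>
  to enriched categories; the values of \<open>W\<close> and \<open>W'\<close> may have different types of objects.
\<close>

definition nat_vcat ::
    "('c, 'm, 'v::comm_quantale) ecat \<Rightarrow>
     ('c, 'm, ('w, 'v) vcat, 'w \<Rightarrow> 'w) fctr \<Rightarrow> ('c, 'm, ('n, 'v) vcat, 'n \<Rightarrow> 'n) fctr \<Rightarrow>
     ('c \<Rightarrow> 'w \<Rightarrow> 'n, 'v) vcat" where
  "nat_vcat K W W' = mk_vcat
     {\<tau> \<in> (\<Pi>\<^sub>E a\<in>Obj K. obj (ihom (fobj W a) (fobj W' a))).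
        \<forall>a\<in>Obj K. \<forall>b\<in>Obj K. \<forall>k\<in>obj (Hom K a b).
          compose (obj (fobj W a)) (farr W' a b k) (\<tau> a) =
          compose (obj (fobj W a)) (\<tau> b) (farr W a b k)}
     (\<lambda>\<sigma> \<tau>. INF a\<in>Obj K. dst (ihom (fobj W a) (fobj W' a)) (\<sigma> a) (\<tau> a))"

text \<open>The functor \<open>M(F-, Y)\<close> from the opposite of the domain \<open>K\<close> of \<open>F\<close>.\<close>

definition hom_into ::
    "('d, 'n, 'v::comm_quantale) ecat \<Rightarrow> ('c, 'm, 'd, 'n) fctr \<Rightarrow> 'd \<Rightarrow>
     ('c, 'm, ('n, 'v) vcat, 'n \<Rightarrow> 'n) fctr" where
  "hom_into M F Y = \<lparr>fobj = (\<lambda>a. Hom M (fobj F a) Y),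
     farr = (\<lambda>a b k. \<lambda>g\<in>obj (Hom M (fobj F a) Y).
       Comp M (fobj F b) (fobj F a) Y g (farr F b a k))\<rparr>"

text \<open>
  \<open>C\<close> with the cylinder \<open>\<lambda> : W \<rightarrow> M(F-, C)\<close> is the colimit \<open>W * F\<close>: composing with \<open>\<lambda>\<close> is an
  isomorphism \<open>M(C, Y) \<cong> [K\<^sup>o\<^sup>p, V-cat](W, M(F-, Y))\<close> for every \<open>Y\<close>.
\<close>

definition is_wcolim ::
    "('c, 'm, 'v::comm_quantale) ecat \<Rightarrow> ('d, 'n, 'v) ecat \<Rightarrow>
     ('c, 'm, ('w, 'v) vcat, 'w \<Rightarrow> 'w) fctr \<Rightarrow> ('c, 'm, 'd, 'n) fctr \<Rightarrow>
     'd \<Rightarrow> ('c \<Rightarrow> 'w \<Rightarrow> 'n) \<Rightarrow> bool" where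
  "is_wcolim K M W F C lam \<longleftrightarrow>
     C \<in> Obj M \<and>
     lam \<in> obj (nat_vcat (op_ecat K) W (hom_into M F C)) \<and>
     (\<forall>Y\<in>Obj M. vcat_iso (Hom M C Y) (nat_vcat (op_ecat K) W (hom_into M F Y))
        (\<lambda>h. \<lambda>a\<in>Obj K. \<lambda>w\<in>obj (fobj W a). Comp M (fobj F a) C Y h (lam a w)))"

definition preserves_wcolim ::
    "('c, 'm, 'v::comm_quantale) ecat \<Rightarrow> ('d, 'n, 'v) ecat \<Rightarrow> ('e, 'k, 'v) ecat \<Rightarrow>
     ('c, 'm, ('w, 'v) vcat, 'w \<Rightarrow> 'w) fctr \<Rightarrow> ('c, 'm, 'd, 'n) fctr \<Rightarrow>
     ('d, 'n, 'e, 'k) fctr \<Rightarrow> bool" where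
  "preserves_wcolim K M M' W F G \<longleftrightarrow> (\<forall>C lam. is_wcolim K M W F C lam \<longrightarrow>
     is_wcolim K M' W (functor_comp G F) (fobj G C)
       (\<lambda>a\<in>Obj K. \<lambda>w\<in>obj (fobj W a). farr G (fobj F a) C (lam a w)))"

text \<open>
  \<open>L\<close> is the left Kan extension of \<open>H : A \<rightarrow> M'\<close> along \<open>J : A \<rightarrow> M\<close>: each \<open>L X\<close> is the colimit
  \<open>M(J-, X) * H\<close>, with cylinders \<open>\<lambda>\<^sub>X\<close> natural in \<open>X\<close>. By the universal property, naturality
  determines \<open>L\<close> on homs.
\<close>

definition is_lan ::
    "('c, 'm, 'v::comm_quantale) ecat \<Rightarrow> ('d, 'n, 'v) ecat \<Rightarrow> ('e, 'k, 'v) ecat \<Rightarrow>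
     ('c, 'm, 'd, 'n) fctr \<Rightarrow> ('c, 'm, 'e, 'k) fctr \<Rightarrow> ('d, 'n, 'e, 'k) fctr \<Rightarrow> bool" where
  "is_lan A M M' J H L \<longleftrightarrow> is_efunctor M M' L \<and> (\<exists>lam.
     (\<forall>X\<in>Obj M. is_wcolim A M' (hom_into M J X) H (fobj L X) (lam X)) \<and>
     (\<forall>X\<in>Obj M. \<forall>X'\<in>Obj M. \<forall>g\<in>obj (Hom M X X'). \<forall>a\<in>Obj A. \<forall>f\<in>obj (Hom M (fobj J a) X).
        Comp M' (fobj H a) (fobj L X) (fobj L X') (farr L X X' g) (lam X a f) =
        lam X' a (Comp M (fobj J a) X X' g f)))"

definition is_vcatification ::
    "('u set, 'u \<Rightarrow> 'u, 'u set, 'u \<Rightarrow> 'u) fctr \<Rightarrow>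
     (('u, 'v::comm_quantale) vcat, 'u \<Rightarrow> 'u, ('u, 'v) vcat, 'u \<Rightarrow> 'u) fctr \<Rightarrow> bool" where
  "is_vcatification T L \<longleftrightarrow> is_lan SETv VCAT VCAT Dfun (functor_comp Dfun T) L"


section \<open>The weight \<open>N\<close> and the diagrams \<open>F\<^sub>X\<close>\<close>

text \<open>
  Objects of the shape: \<open>Some r\<close> for \<open>r\<close> in the quantale, and \<open>None\<close> for the extra object \<open>o\<close>.
\<close>

datatype narr = Idn | Del0 | Del1

definition Ncat :: "('v option, narr) cat" where
  "Ncat = \<lparr>Ob = UNIV,
     Ar = (\<lambda>a b. if a = b then {Idn} else if a \<noteq> None \<and> b = None then {Del0, Del1} else {}),
     cmp = (\<lambda>a b c g f. if f = Idn then g else f), idn = (\<lambda>a. Idn)\<rparr>"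

abbreviation Nv :: "('v option, narr, 'v::comm_quantale) ecat" where
  "Nv \<equiv> free_ecat Ncat"

text \<open>
  As a functor on the opposite category, \<open>Nwt\<close> sends \<open>Del0, Del1\<close> to maps from the unit enriched
  category, whose only object is \<open>0\<close>.
\<close>

definition Nwt :: "('v option, narr, (nat, 'v::comm_quantale) vcat, nat \<Rightarrow> nat) fctr" where
  "Nwt = (let W = (\<lambda>a. case a of None \<Rightarrow> unit_vcat | Some r \<Rightarrow> two_vcat r) in
     \<lparr>fobj = W,
      farr = (\<lambda>a b k. \<lambda>i\<in>obj (W a). case k of Idn \<Rightarrow> i | Del0 \<Rightarrow> 0 | Del1 \<Rightarrow> 1)\<rparr>)"

text \<open>
  The sets \<open>{(x', x). r \<le> X(x', x)}\<close> are to be small sets, hence subsets of \<open>'u\<close>, so pairs are coded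
  by a fixed injection, which exists when \<open>'u\<close> is infinite.
\<close>

definition pcode :: "'u \<times> 'u \<Rightarrow> 'u" where
  "pcode = (SOME p. inj p)"

definition Fdiag :: "('u, 'v::comm_quantale) vcat \<Rightarrow> ('v option, narr, 'u set, 'u \<Rightarrow> 'u) fctr" where
  "Fdiag X = (let S = (\<lambda>a. case a of None \<Rightarrow> obj X
       | Some r \<Rightarrow> pcode ` {(x', x). x' \<in> obj X \<and> x \<in> obj X \<and> r \<le> dst X x' x}) in
     \<lparr>fobj = S,
      farr = (\<lambda>a b k. \<lambda>p\<in>S a. case k of Idn \<Rightarrow> p
        | Del0 \<Rightarrow> fst (the_inv pcode p) | Del1 \<Rightarrow> snd (the_inv pcode p))\<rparr>)"

lemma inj_pcode:
  assumes "infinite (UNIV :: 'u set)"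
  shows "inj (pcode :: 'u \<times> 'u \<Rightarrow> 'u)"
proof -
  have "|(UNIV :: 'u set) \<times> (UNIV :: 'u set)| \<le>o |UNIV :: 'u set|"
    using card_of_Times_same_infinite[OF assms] ordIso_iff_ordLeq by blast
  then obtain p :: "'u \<times> 'u \<Rightarrow> 'u" where "inj p"
    using card_of_ordLeq[of "(UNIV :: 'u set) \<times> (UNIV :: 'u set)" "UNIV :: 'u set"] by auto
  then show ?thesis unfolding pcode_def by (rule someI[where P = inj])
qed

end

(*
  The enriched category X is the colimit of its diagram (N, DF_X), with D(obj X) -> X as the
  component at the object o; hence a colimit-preserving G has G X as a quotient of G D(obj X).
  Conversely every functor DA -> X factors through D(obj X) -> X, and two functors DA -> X at
  distance at least r factor jointly through D(X_r). So cylinders under V-cat(D-, X) with values in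
  V-cat(H-, Y) and legs out of H(obj X) compatible with the projections from X_r are the same thing,
  which identifies the universal property of the Kan extension at X with that of the colimit.
  Integrality makes V-cat(D-, DA) discrete, and then Yoneda identifies the value of the Kan extension
  at DA with D(T A).
*)
theory Submission
  imports Defs
begin

section \<open>The self-enriched category of enriched categories\<close>

text \<open>Arrows of \<open>VCAT\<close> are bare extensional functions, so \<open>cover X\<close>,
  the identity of X and the identity of D(obj X) are one and the same function. Factoring through
  the cover therefore changes only the hom in which a function is read; this matters because
  \<open>farr G\<close> takes domain and codomain as arguments. Composition with
  \<open>cover X\<close> does nothing to functions, and the content of its universal property sits
  in the quantifier over r: testing at r = X(x', x) recovers V-functoriality. From preservation to
  Kan extension, T sends A to the set of objects of G(DA); preservation of discreteness makes D(T A)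
  literally equal to G(DA), and the universal cylinder is f |-> G f. In the other direction D(T A)
  and G(DA) are only isomorphic, so legs have to be transported along a natural isomorphism b.
  Integrality is felt at the empty set: the only function out of the empty discrete category has as
  self-distance an infimum over nothing, which is top, whereas a discrete hom requires the value
  1.\<close>

lemma quantale_mult_mono:
  fixes a b c d :: "'v::comm_quantale"
  assumes "a \<le> b" "c \<le> d"
  shows "a * c \<le> b * d"
proof -
  \<comment> \<open>Left monotonicity follows from the adjunction applied with s =
    \<open>y * z\<close>; commutativity then covers the right argument.\<close>
  have *: "x * z \<le> y * z" if "x \<le> y" for x y z :: 'v
    using that residuation[of y z "y * z"] residuation[of x z "y * z"] by auto
  show ?thesis
    using *[OF assms(1), of c] *[OF assms(2), of b] by (simp add: mult.commute)
qed

lemma mult_bot_left [simp]: "bot * (a :: 'v::comm_quantale) = bot"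
  using residuation[of bot a bot] by (simp add: bot_unique)

lemma obj_mk_vcat [simp]: "obj (mk_vcat A d) = A"
  by (simp add: mk_vcat_def)

lemma dst_mk_vcat: "dst (mk_vcat A d) x y = (if x \<in> A \<and> y \<in> A then d x y else bot)"
  by (simp add: mk_vcat_def)

lemma vcat_refl: "is_vcat X \<Longrightarrow> x \<in> obj X \<Longrightarrow> 1 \<le> dst X x x"
  by (simp add: is_vcat_def)

lemma vcat_trans:
  "is_vcat X \<Longrightarrow> x \<in> obj X \<Longrightarrow> y \<in> obj X \<Longrightarrow> z \<in> obj X \<Longrightarrow> dst X y z * dst X x y \<le> dst X x z"
  by (simp add: is_vcat_def)

lemma vfunctor_obj: "is_vfunctor X Y f \<Longrightarrow> x \<in> obj X \<Longrightarrow> f x \<in> obj Y"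
  by (auto simp: is_vfunctor_def)

lemma vfunctor_dst:
  "is_vfunctor X Y f \<Longrightarrow> x \<in> obj X \<Longrightarrow> y \<in> obj X \<Longrightarrow> dst X x y \<le> dst Y (f x) (f y)"
  by (auto simp: is_vfunctor_def)

lemma vfunctor_comp:
  assumes f: "is_vfunctor X Y f" and g: "is_vfunctor Y Z g"
  shows "is_vfunctor X Z (\<lambda>x. g (f x))"
  unfolding is_vfunctor_def
  using order_trans[OF vfunctor_dst[OF f] vfunctor_dst[OF g]] vfunctor_obj[OF f] vfunctor_obj[OF g]
  by auto

lemma obj_ihom: "f \<in> obj (ihom Y Z) \<longleftrightarrow> f \<in> extensional (obj Y) \<and> is_vfunctor Y Z f"
  by (simp add: ihom_def)

lemma ihom_app: "f \<in> obj (ihom Y Z) \<Longrightarrow> y \<in> obj Y \<Longrightarrow> f y \<in> obj Z"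
  using vfunctor_obj[of Y Z f y] by (simp add: obj_ihom)

lemma dst_ihom:
  "f \<in> obj (ihom Y Z) \<Longrightarrow> g \<in> obj (ihom Y Z) \<Longrightarrow>
    dst (ihom Y Z) f g = (INF y\<in>obj Y. dst Z (f y) (g y))"
  by (simp add: ihom_def dst_mk_vcat)

lemma is_vcat_ihom:
  fixes Y :: "('o, 'v::comm_quantale) vcat" and Z :: "('p, 'v) vcat"
  assumes Z: "is_vcat Z"
  shows "is_vcat (ihom Y Z)"
  unfolding is_vcat_def
proof (intro conjI ballI allI impI)
  fix f assume f: "f \<in> obj (ihom Y Z)"
  then show "1 \<le> dst (ihom Y Z) f f"
    unfolding dst_ihom[OF f f] by (intro INF_greatest vcat_refl Z ihom_app[OF f])
next
  fix f g h assume *: "f \<in> obj (ihom Y Z)" "g \<in> obj (ihom Y Z)" "h \<in> obj (ihom Y Z)"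
  show "dst (ihom Y Z) g h * dst (ihom Y Z) f g \<le> dst (ihom Y Z) f h"
    unfolding dst_ihom[OF *(1,3)]
  proof (rule INF_greatest)
    fix y assume y: "y \<in> obj Y"
    have "dst (ihom Y Z) g h * dst (ihom Y Z) f g \<le> dst Z (g y) (h y) * dst Z (f y) (g y)"
      unfolding dst_ihom[OF *(2,3)] dst_ihom[OF *(1,2)]
      by (intro quantale_mult_mono INF_lower y)
    also have "\<dots> \<le> dst Z (f y) (h y)"
      using * y by (intro vcat_trans Z) (auto simp: ihom_app)
    finally show "dst (ihom Y Z) g h * dst (ihom Y Z) f g \<le> dst Z (f y) (h y)" .
  qed
next
  fix f g assume "f \<notin> obj (ihom Y Z) \<or> g \<notin> obj (ihom Y Z)"
  then show "dst (ihom Y Z) f g = bot"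
    by (auto simp: ihom_def dst_mk_vcat)
qed

lemma compose_in_ihom:
  "f \<in> obj (ihom X Y) \<Longrightarrow> g \<in> obj (ihom Y Z) \<Longrightarrow> compose (obj X) g f \<in> obj (ihom X Z)"
  using vfunctor_comp[of X Y f Z g] by (simp add: obj_ihom compose_def is_vfunctor_def Pi_iff)

lemma id_in_ihom: "(\<lambda>x\<in>obj X. x) \<in> obj (ihom X X)"
  by (simp add: obj_ihom is_vfunctor_def)

lemma VCAT_of_simps:
  "Obj (VCAT_of U) = {X. is_vcat X \<and> obj X \<in> U}"
  "Hom (VCAT_of U) = ihom"
  "Comp (VCAT_of U) X Y Z g f = compose (obj X) g f"
  "Id (VCAT_of U) X = (\<lambda>x\<in>obj X. x)"
  by (simp_all add: VCAT_of_def)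

text \<open>The path runs through g' (f x): the V-functor g' carries the distance from f' x to f x,
  and the triangle inequality adds the distance from g' to g at the point f x.\<close>

lemma dst_compose_le:
  fixes X :: "('o, 'v::comm_quantale) vcat"
  assumes Z: "is_vcat Z"
    and f: "f \<in> obj (ihom X Y)" "f' \<in> obj (ihom X Y)"
    and g: "g \<in> obj (ihom Y Z)" "g' \<in> obj (ihom Y Z)"
  shows "dst (ihom Y Z) g' g * dst (ihom X Y) f' f
    \<le> dst (ihom X Z) (compose (obj X) g' f') (compose (obj X) g f)"
proof -
  have "dst (ihom Y Z) g' g * dst (ihom X Y) f' f
      \<le> dst Z (compose (obj X) g' f' x) (compose (obj X) g f x)" if x: "x \<in> obj X" for x
  proof -
    have fx: "f x \<in> obj Y" "f' x \<in> obj Y"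
      using f x by (auto simp: ihom_app)
    have "dst (ihom X Y) f' f \<le> dst Y (f' x) (f x)"
      using f x by (auto simp: dst_ihom intro: INF_lower)
    also have "\<dots> \<le> dst Z (g' (f' x)) (g' (f x))"
      using g fx by (auto simp: obj_ihom vfunctor_dst)
    finally have "dst (ihom Y Z) g' g * dst (ihom X Y) f' f
        \<le> dst Z (g' (f x)) (g (f x)) * dst Z (g' (f' x)) (g' (f x))"
      using g fx by (intro quantale_mult_mono) (auto simp: dst_ihom intro: INF_lower)
    also have "\<dots> \<le> dst Z (g' (f' x)) (g (f x))"
      using g fx by (intro vcat_trans Z) (auto simp: ihom_app)
    finally show ?thesis using x by (simp add: compose_eq)
  qed
  then show ?thesis
    using f g by (auto simp: dst_ihom compose_in_ihom intro!: INF_greatest)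
qed

lemma is_ecat_VCAT_of: "is_ecat (VCAT_of U :: (('o, 'v::comm_quantale) vcat, _, _) ecat)"
  unfolding is_ecat_def
proof (intro conjI ballI)
  fix X Y Z :: "('o, 'v) vcat"
  assume "X \<in> Obj (VCAT_of U)" "Y \<in> Obj (VCAT_of U)" "Z \<in> Obj (VCAT_of U)"
  then show "is_vfunctor
      (tensor_vcat (Hom (VCAT_of U) Y Z) (Hom (VCAT_of U) X Y)) (Hom (VCAT_of U) X Z)
      (\<lambda>(g, f). Comp (VCAT_of U) X Y Z g f)"
    by (auto simp: VCAT_of_simps is_vfunctor_def tensor_vcat_def dst_mk_vcat dst_compose_le compose_in_ihom)
next
  \<comment> \<open>Arrows are extensional, so the unit laws are equalities of functions also
    outside the set of objects.\<close>
  fix X Y f assume "f \<in> obj (Hom (VCAT_of U :: (('o, 'v) vcat, _, _) ecat) X Y)"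
  then have f: "f \<in> extensional (obj X)" "f \<in> obj X \<rightarrow> obj Y"
    by (auto simp: VCAT_of_simps obj_ihom is_vfunctor_def)
  then show "Comp (VCAT_of U) X X Y f (Id (VCAT_of U) X) = f"
    and "Comp (VCAT_of U) X Y Y (Id (VCAT_of U) Y) f = f"
    by (auto simp: VCAT_of_simps compose_def fun_eq_iff extensional_def)
next
  fix X :: "('o, 'v) vcat" assume "X \<in> Obj (VCAT_of U)"
  show "Id (VCAT_of U) X \<in> obj (Hom (VCAT_of U) X X)"
    by (simp add: VCAT_of_simps id_in_ihom)
next
  fix X Y Z V f g h
  assume "f \<in> obj (Hom (VCAT_of U :: (('o, 'v) vcat, _, _) ecat) X Y)"
  then show "Comp (VCAT_of U) X Y V (Comp (VCAT_of U) Y Z V h g) f =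
      Comp (VCAT_of U) X Z V h (Comp (VCAT_of U) X Y Z g f)"
    by (simp add: VCAT_of_simps compose_def fun_eq_iff ihom_app)
qed (simp add: VCAT_of_simps is_vcat_ihom)


section \<open>Cylinders and weighted colimits\<close>

locale ecat =
  fixes M :: "('d, 'n, 'v::comm_quantale) ecat"
  assumes ecat: "is_ecat M"
begin

lemma is_vcat_Hom: "a \<in> Obj M \<Longrightarrow> b \<in> Obj M \<Longrightarrow> is_vcat (Hom M a b)"
  using ecat by (simp add: is_ecat_def)

lemma Id_in: "a \<in> Obj M \<Longrightarrow> Id M a \<in> obj (Hom M a a)"
  using ecat by (simp add: is_ecat_def)

lemma Comp_vfunctor: "a \<in> Obj M \<Longrightarrow> b \<in> Obj M \<Longrightarrow> c \<in> Obj M \<Longrightarrow>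
    is_vfunctor (tensor_vcat (Hom M b c) (Hom M a b)) (Hom M a c) (\<lambda>(g, f). Comp M a b c g f)"
  using ecat by (simp add: is_ecat_def)

lemma Comp_in: "a \<in> Obj M \<Longrightarrow> b \<in> Obj M \<Longrightarrow> c \<in> Obj M \<Longrightarrow>
    f \<in> obj (Hom M a b) \<Longrightarrow> g \<in> obj (Hom M b c) \<Longrightarrow> Comp M a b c g f \<in> obj (Hom M a c)"
  using vfunctor_obj[OF Comp_vfunctor, of a b c "(g, f)"] by (simp add: tensor_vcat_def)

lemma Comp_dst:
  assumes "a \<in> Obj M" "b \<in> Obj M" "c \<in> Obj M"
    "f \<in> obj (Hom M a b)" "f' \<in> obj (Hom M a b)" "g \<in> obj (Hom M b c)" "g' \<in> obj (Hom M b c)"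
  shows "dst (Hom M b c) g g' * dst (Hom M a b) f f'
    \<le> dst (Hom M a c) (Comp M a b c g f) (Comp M a b c g' f')"
  using vfunctor_dst[OF Comp_vfunctor, of a b c "(g, f)" "(g', f')"] assms
  by (simp add: tensor_vcat_def dst_mk_vcat)

text \<open>Composition is a V-functor on the tensor product; keeping f fixed costs nothing because
  its self-distance is at least the unit.\<close>

lemma Comp_dst_left:
  assumes "a \<in> Obj M" "b \<in> Obj M" "c \<in> Obj M"
    "f \<in> obj (Hom M a b)" "g \<in> obj (Hom M b c)" "g' \<in> obj (Hom M b c)"
  shows "dst (Hom M b c) g g' \<le> dst (Hom M a c) (Comp M a b c g f) (Comp M a b c g' f)"
proof -
  have "dst (Hom M b c) g g' * 1 \<le> dst (Hom M b c) g g' * dst (Hom M a b) f f"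
    using assms by (intro quantale_mult_mono order_refl vcat_refl is_vcat_Hom)
  then show ?thesis using Comp_dst[of a b c f f g g'] assms by auto
qed

lemma Comp_dst_right:
  assumes "a \<in> Obj M" "b \<in> Obj M" "c \<in> Obj M"
    "f \<in> obj (Hom M a b)" "f' \<in> obj (Hom M a b)" "g \<in> obj (Hom M b c)"
  shows "dst (Hom M a b) f f' \<le> dst (Hom M a c) (Comp M a b c g f) (Comp M a b c g f')"
proof -
  have "1 * dst (Hom M a b) f f' \<le> dst (Hom M b c) g g * dst (Hom M a b) f f'"
    using assms by (intro quantale_mult_mono order_refl vcat_refl is_vcat_Hom)
  then show ?thesis using Comp_dst[of a b c f f' g g] assms by auto
qed

lemma Comp_Id: "a \<in> Obj M \<Longrightarrow> b \<in> Obj M \<Longrightarrow> f \<in> obj (Hom M a b) \<Longrightarrow> Comp M a a b f (Id M a) = f"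
  using ecat by (simp add: is_ecat_def)

lemma Id_Comp: "a \<in> Obj M \<Longrightarrow> b \<in> Obj M \<Longrightarrow> f \<in> obj (Hom M a b) \<Longrightarrow> Comp M a b b (Id M b) f = f"
  using ecat by (simp add: is_ecat_def)

lemma Comp_assoc: "a \<in> Obj M \<Longrightarrow> b \<in> Obj M \<Longrightarrow> c \<in> Obj M \<Longrightarrow> d \<in> Obj M \<Longrightarrow>
    f \<in> obj (Hom M a b) \<Longrightarrow> g \<in> obj (Hom M b c) \<Longrightarrow> h \<in> obj (Hom M c d) \<Longrightarrow>
    Comp M a b d (Comp M b c d h g) f = Comp M a c d h (Comp M a b c g f)"
  using ecat by (simp add: is_ecat_def)

end

lemma efunctor_obj: "is_efunctor K L F \<Longrightarrow> a \<in> Obj K \<Longrightarrow> fobj F a \<in> Obj L"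
  by (simp add: is_efunctor_def)

lemma efunctor_vfunctor: "is_efunctor K L F \<Longrightarrow> a \<in> Obj K \<Longrightarrow> b \<in> Obj K \<Longrightarrow>
    is_vfunctor (Hom K a b) (Hom L (fobj F a) (fobj F b)) (farr F a b)"
  by (simp add: is_efunctor_def)

lemma efunctor_arr: "is_efunctor K L F \<Longrightarrow> a \<in> Obj K \<Longrightarrow> b \<in> Obj K \<Longrightarrow>
    f \<in> obj (Hom K a b) \<Longrightarrow> farr F a b f \<in> obj (Hom L (fobj F a) (fobj F b))"
  by (blast intro: vfunctor_obj efunctor_vfunctor)

lemma efunctor_Id: "is_efunctor K L F \<Longrightarrow> a \<in> Obj K \<Longrightarrow> farr F a a (Id K a) = Id L (fobj F a)"
  by (simp add: is_efunctor_def)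

lemma efunctor_Comp: "is_efunctor K L F \<Longrightarrow> a \<in> Obj K \<Longrightarrow> b \<in> Obj K \<Longrightarrow> c \<in> Obj K \<Longrightarrow>
    f \<in> obj (Hom K a b) \<Longrightarrow> g \<in> obj (Hom K b c) \<Longrightarrow> farr F a c (Comp K a b c g f) =
      Comp L (fobj F a) (fobj F b) (fobj F c) (farr F b c g) (farr F a b f)"
  by (simp add: is_efunctor_def)

lemma is_efunctor_comp:
  assumes F: "is_efunctor K L F" and G: "is_efunctor L M G"
  shows "is_efunctor K M (functor_comp G F)"
  unfolding is_efunctor_def functor_comp_def
proof (intro conjI ballI; simp)
  fix a b assume ab: "a \<in> Obj K" "b \<in> Obj K"
  show "is_vfunctor (Hom K a b) (Hom M (fobj G (fobj F a)) (fobj G (fobj F b)))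
      (\<lambda>k. farr G (fobj F a) (fobj F b) (farr F a b k))"
    by (intro vfunctor_comp[OF efunctor_vfunctor[OF F ab]] efunctor_vfunctor[OF G]
        efunctor_obj[OF F] ab)
qed (auto simp: efunctor_obj[OF F] efunctor_obj[OF G] efunctor_Id[OF F] efunctor_Id[OF G]
    efunctor_Comp[OF F] efunctor_Comp[OF G] efunctor_arr[OF F])

text \<open>The objects of \<open>nat_vcat (op_ecat K) W (hom_into M F Y)\<close> in elementary
  form: the opposite category is unfolded and naturality becomes an equation at each element w of
  the weight.\<close>

definition cylinder ::
    "('c, 'm, 'v::comm_quantale) ecat \<Rightarrow> ('d, 'n, 'v) ecat \<Rightarrow>
     ('c, 'm, ('w, 'v) vcat, 'w \<Rightarrow> 'w) fctr \<Rightarrow> ('c, 'm, 'd, 'n) fctr \<Rightarrow>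
     'd \<Rightarrow> ('c \<Rightarrow> 'w \<Rightarrow> 'n) \<Rightarrow> bool" where
  "cylinder K M W F Y \<sigma> \<longleftrightarrow> \<sigma> \<in> extensional (Obj K) \<and>
     (\<forall>a\<in>Obj K. \<sigma> a \<in> obj (ihom (fobj W a) (Hom M (fobj F a) Y))) \<and>
     (\<forall>a\<in>Obj K. \<forall>b\<in>Obj K. \<forall>k\<in>obj (Hom K b a). \<forall>w\<in>obj (fobj W a).
        Comp M (fobj F b) (fobj F a) Y (\<sigma> a w) (farr F b a k) = \<sigma> b (farr W a b k w))"

lemma cylinder_in: "cylinder K M W F Y \<sigma> \<Longrightarrow> a \<in> Obj K \<Longrightarrow> w \<in> obj (fobj W a) \<Longrightarrow>
    \<sigma> a w \<in> obj (Hom M (fobj F a) Y)"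
  by (auto simp: cylinder_def obj_ihom is_vfunctor_def)

lemma cylinder_dst: "cylinder K M W F Y \<sigma> \<Longrightarrow> a \<in> Obj K \<Longrightarrow> w \<in> obj (fobj W a) \<Longrightarrow>
    w' \<in> obj (fobj W a) \<Longrightarrow> dst (fobj W a) w w' \<le> dst (Hom M (fobj F a) Y) (\<sigma> a w) (\<sigma> a w')"
  by (auto simp: cylinder_def obj_ihom is_vfunctor_def)

lemma cylinder_natural: "cylinder K M W F Y \<sigma> \<Longrightarrow> a \<in> Obj K \<Longrightarrow> b \<in> Obj K \<Longrightarrow>
    k \<in> obj (Hom K b a) \<Longrightarrow> w \<in> obj (fobj W a) \<Longrightarrow>
    Comp M (fobj F b) (fobj F a) Y (\<sigma> a w) (farr F b a k) = \<sigma> b (farr W a b k w)"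
  by (auto simp: cylinder_def)

lemma cylinder_eqI:
  assumes "cylinder K M W F Y \<sigma>" "cylinder K M W F Y \<tau>"
    "\<And>a w. a \<in> Obj K \<Longrightarrow> w \<in> obj (fobj W a) \<Longrightarrow> \<sigma> a w = \<tau> a w"
  shows "\<sigma> = \<tau>"
proof (rule extensionalityI)
  fix a assume "a \<in> Obj K"
  then show "\<sigma> a = \<tau> a"
    using assms by (intro extensionalityI[of _ "obj (fobj W a)"]) (auto simp: cylinder_def obj_ihom)
qed (use assms in \<open>auto simp: cylinder_def\<close>)

lemma op_ecat_simps [simp]:
  "Obj (op_ecat K) = Obj K" "Hom (op_ecat K) a b = Hom K b a"
  by (simp_all add: op_ecat_def)

lemma hom_into_simps [simp]:
  "fobj (hom_into M F Y) a = Hom M (fobj F a) Y"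
  "farr (hom_into M F Y) a b k =
    (\<lambda>g\<in>obj (Hom M (fobj F a) Y). Comp M (fobj F b) (fobj F a) Y g (farr F b a k))"
  by (simp_all add: hom_into_def)

text \<open>The operator \<open>compose\<close> and the restriction inside \<open>hom_into\<close>
  only cut functions down to their sets of objects, so equality of the two composites is a pointwise
  equation.\<close>

lemma obj_nat_vcat:
  "\<sigma> \<in> obj (nat_vcat (op_ecat K) W (hom_into M F Y)) \<longleftrightarrow> cylinder K M W F Y \<sigma>"
proof -
  have *: "(compose (obj (fobj W a)) (farr (hom_into M F Y) a b k) (\<sigma> a)
        = compose (obj (fobj W a)) (\<sigma> b) (farr W a b k)) \<longleftrightarrow>
      (\<forall>w\<in>obj (fobj W a).
        Comp M (fobj F b) (fobj F a) Y (\<sigma> a w) (farr F b a k) = \<sigma> b (farr W a b k w))"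
    (is "?l \<longleftrightarrow> ?r")
    if "\<sigma> a \<in> obj (ihom (fobj W a) (Hom M (fobj F a) Y))" for a b k
  proof -
    have "?l \<longleftrightarrow> (\<forall>w\<in>obj (fobj W a).
        farr (hom_into M F Y) a b k (\<sigma> a w) = \<sigma> b (farr W a b k w))"
      by (auto simp: compose_def fun_eq_iff)
    also have "\<dots> \<longleftrightarrow> ?r"
      using that by (simp add: ihom_app)
    finally show ?thesis .
  qed
  have "\<sigma> \<in> obj (nat_vcat (op_ecat K) W (hom_into M F Y)) \<longleftrightarrow>
      \<sigma> \<in> extensional (Obj K) \<and>
      (\<forall>a\<in>Obj K. \<sigma> a \<in> obj (ihom (fobj W a) (Hom M (fobj F a) Y))) \<and>
      (\<forall>a\<in>Obj K. \<forall>b\<in>Obj K. \<forall>k\<in>obj (Hom K b a).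
        compose (obj (fobj W a)) (farr (hom_into M F Y) a b k) (\<sigma> a)
          = compose (obj (fobj W a)) (\<sigma> b) (farr W a b k))"
    by (simp only: nat_vcat_def obj_mk_vcat mem_Collect_eq op_ecat_simps hom_into_simps(1)
        PiE_iff conj_assoc conj_commute conj_left_commute)
  also have "\<dots> \<longleftrightarrow> cylinder K M W F Y \<sigma>"
    unfolding cylinder_def using * by (intro conj_cong ball_cong refl) blast
  finally show ?thesis .
qed

lemma dst_nat_vcat:
  assumes "cylinder K M W F Y \<sigma>" "cylinder K M W F Y \<tau>"
  shows "dst (nat_vcat (op_ecat K) W (hom_into M F Y)) \<sigma> \<tau> =
    (INF a\<in>Obj K. INF w\<in>obj (fobj W a). dst (Hom M (fobj F a) Y) (\<sigma> a w) (\<tau> a w))"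
proof -
  have "dst (nat_vcat (op_ecat K) W (hom_into M F Y)) \<sigma> \<tau> =
      (INF a\<in>Obj K. dst (ihom (fobj W a) (Hom M (fobj F a) Y)) (\<sigma> a) (\<tau> a))"
    using assms[folded obj_nat_vcat]
    by (simp add: nat_vcat_def dst_mk_vcat)
  also have "\<dots> = (INF a\<in>Obj K. INF w\<in>obj (fobj W a). dst (Hom M (fobj F a) Y) (\<sigma> a w) (\<tau> a w))"
    using assms by (intro INF_cong refl dst_ihom) (auto simp: cylinder_def)
  finally show ?thesis .
qed

definition post ::
    "('c, 'm, 'v::comm_quantale) ecat \<Rightarrow> ('d, 'n, 'v) ecat \<Rightarrow>
     ('c, 'm, ('w, 'v) vcat, 'w \<Rightarrow> 'w) fctr \<Rightarrow> ('c, 'm, 'd, 'n) fctr \<Rightarrow>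
     'd \<Rightarrow> ('c \<Rightarrow> 'w \<Rightarrow> 'n) \<Rightarrow> 'd \<Rightarrow> 'n \<Rightarrow> 'c \<Rightarrow> 'w \<Rightarrow> 'n" where
  "post K M W F C lam Y h = (\<lambda>a\<in>Obj K. \<lambda>w\<in>obj (fobj W a). Comp M (fobj F a) C Y h (lam a w))"

lemma post_apply [simp]: "a \<in> Obj K \<Longrightarrow> w \<in> obj (fobj W a) \<Longrightarrow>
    post K M W F C lam Y h a w = Comp M (fobj F a) C Y h (lam a w)"
  by (simp add: post_def)

lemma is_wcolim_iff: "is_wcolim K M W F C lam \<longleftrightarrow> C \<in> Obj M \<and> cylinder K M W F C lam \<and>
    (\<forall>Y\<in>Obj M. vcat_iso (Hom M C Y) (nat_vcat (op_ecat K) W (hom_into M F Y))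
      (post K M W F C lam Y))"
  by (simp add: is_wcolim_def obj_nat_vcat post_def[abs_def])

section \<open>Universal property of weighted colimits: recognising it, using it, transporting
  it\<close>

locale weighted_diagram = ecat M for M :: "('d, 'n, 'v::comm_quantale) ecat" +
  fixes K :: "('c, 'm, 'v) ecat"
    and W :: "('c, 'm, ('w, 'v) vcat, 'w \<Rightarrow> 'w) fctr"
    and F :: "('c, 'm, 'd, 'n) fctr"
  assumes F: "is_efunctor K M F"
    and W_arr: "\<lbrakk>a \<in> Obj K; b \<in> Obj K; k \<in> obj (Hom K b a); w \<in> obj (fobj W a)\<rbrakk> \<Longrightarrow>
      farr W a b k w \<in> obj (fobj W b)"
begin

lemmas F_obj = efunctor_obj[OF F]
lemmas F_arr = efunctor_arr[OF F]

lemma cylinderI: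
  assumes "\<sigma> \<in> extensional (Obj K)"
    and "\<And>a. a \<in> Obj K \<Longrightarrow> \<sigma> a \<in> extensional (obj (fobj W a))"
    and "\<And>a w. a \<in> Obj K \<Longrightarrow> w \<in> obj (fobj W a) \<Longrightarrow> \<sigma> a w \<in> obj (Hom M (fobj F a) Y)"
    and "\<And>a w w'. a \<in> Obj K \<Longrightarrow> w \<in> obj (fobj W a) \<Longrightarrow> w' \<in> obj (fobj W a) \<Longrightarrow>
      dst (fobj W a) w w' \<le> dst (Hom M (fobj F a) Y) (\<sigma> a w) (\<sigma> a w')"
    and "\<And>a b k w. a \<in> Obj K \<Longrightarrow> b \<in> Obj K \<Longrightarrow> k \<in> obj (Hom K b a) \<Longrightarrow> w \<in> obj (fobj W a) \<Longrightarrow>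
      Comp M (fobj F b) (fobj F a) Y (\<sigma> a w) (farr F b a k) = \<sigma> b (farr W a b k w)"
  shows "cylinder K M W F Y \<sigma>"
  using assms by (simp add: cylinder_def obj_ihom is_vfunctor_def)

lemma cylinder_post:
  assumes C: "C \<in> Obj M" and Y: "Y \<in> Obj M" and lam: "cylinder K M W F C lam"
    and h: "h \<in> obj (Hom M C Y)"
  shows "cylinder K M W F Y (post K M W F C lam Y h)"
proof (rule cylinderI)
  fix a w assume aw: "a \<in> Obj K" "w \<in> obj (fobj W a)"
  then show "post K M W F C lam Y h a w \<in> obj (Hom M (fobj F a) Y)"
    using C Y h by (simp add: Comp_in[OF F_obj] cylinder_in[OF lam])
next
  fix a w w' assume aw: "a \<in> Obj K" "w \<in> obj (fobj W a)" "w' \<in> obj (fobj W a)"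
  have "dst (fobj W a) w w' \<le> dst (Hom M (fobj F a) C) (lam a w) (lam a w')"
    using cylinder_dst[OF lam] aw by simp
  also have "\<dots> \<le> dst (Hom M (fobj F a) Y) (Comp M (fobj F a) C Y h (lam a w))
      (Comp M (fobj F a) C Y h (lam a w'))"
    using aw by (intro Comp_dst_right C Y F_obj h cylinder_in[OF lam])
  finally show "dst (fobj W a) w w' \<le> dst (Hom M (fobj F a) Y)
      (post K M W F C lam Y h a w) (post K M W F C lam Y h a w')"
    using aw by simp
next
  fix a b k w assume *: "a \<in> Obj K" "b \<in> Obj K" "k \<in> obj (Hom K b a)" "w \<in> obj (fobj W a)"
  have "Comp M (fobj F b) (fobj F a) Y (Comp M (fobj F a) C Y h (lam a w)) (farr F b a k) =
      Comp M (fobj F b) C Y h (Comp M (fobj F b) (fobj F a) C (lam a w) (farr F b a k))"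
    using * by (intro Comp_assoc C Y F_obj h cylinder_in[OF lam] F_arr)
  then show "Comp M (fobj F b) (fobj F a) Y (post K M W F C lam Y h a w) (farr F b a k) =
      post K M W F C lam Y h b (farr W a b k w)"
    using * by (simp add: W_arr cylinder_natural[OF lam])
qed (simp_all add: post_def)

text \<open>An isomorphism of enriched categories is a bijection that preserves and reflects
  distances. Preservation comes from functoriality of composition, which leaves existence,
  uniqueness and reflection. Reflection is phrased with an arbitrary lower bound r in place of the
  double infimum over a and w.\<close>

lemma wcolimI:
  assumes C: "C \<in> Obj M" and lam: "cylinder K M W F C lam"
    and ex: "\<And>Y \<sigma>. Y \<in> Obj M \<Longrightarrow> cylinder K M W F Y \<sigma> \<Longrightarrow> \<exists>h\<in>obj (Hom M C Y).
      \<forall>a\<in>Obj K. \<forall>w\<in>obj (fobj W a). Comp M (fobj F a) C Y h (lam a w) = \<sigma> a w"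
    and uniq: "\<And>Y h h'. \<lbrakk>Y \<in> Obj M; h \<in> obj (Hom M C Y); h' \<in> obj (Hom M C Y);
      \<And>a w. a \<in> Obj K \<Longrightarrow> w \<in> obj (fobj W a) \<Longrightarrow>
        Comp M (fobj F a) C Y h (lam a w) = Comp M (fobj F a) C Y h' (lam a w)\<rbrakk> \<Longrightarrow> h = h'"
    and dist: "\<And>Y h h' r. \<lbrakk>Y \<in> Obj M; h \<in> obj (Hom M C Y); h' \<in> obj (Hom M C Y);
      \<And>a w. a \<in> Obj K \<Longrightarrow> w \<in> obj (fobj W a) \<Longrightarrow>
        r \<le> dst (Hom M (fobj F a) Y)
          (Comp M (fobj F a) C Y h (lam a w)) (Comp M (fobj F a) C Y h' (lam a w))\<rbrakk> \<Longrightarrow>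
      r \<le> dst (Hom M C Y) h h'"
  shows "is_wcolim K M W F C lam"
  unfolding is_wcolim_iff
proof (intro conjI ballI C lam)
  fix Y assume Y: "Y \<in> Obj M"
  let ?N = "nat_vcat (op_ecat K) W (hom_into M F Y)" and ?p = "post K M W F C lam Y"
  define g where "g \<sigma> = (SOME h. h \<in> obj (Hom M C Y) \<and>
    (\<forall>a\<in>Obj K. \<forall>w\<in>obj (fobj W a). Comp M (fobj F a) C Y h (lam a w) = \<sigma> a w))" for \<sigma>
  have g: "g \<sigma> \<in> obj (Hom M C Y) \<and>
      (\<forall>a\<in>Obj K. \<forall>w\<in>obj (fobj W a). Comp M (fobj F a) C Y (g \<sigma>) (lam a w) = \<sigma> a w)"
    if "cylinder K M W F Y \<sigma>" for \<sigma>
    unfolding g_def by (rule someI_ex) (use ex[OF Y that] in blast)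
  have p: "cylinder K M W F Y (?p h)" if "h \<in> obj (Hom M C Y)" for h
    by (rule cylinder_post[OF C Y lam that])
  show "vcat_iso (Hom M C Y) ?N ?p"
    unfolding vcat_iso_def
  proof (intro conjI exI[of _ g] ballI)
    show "is_vfunctor (Hom M C Y) ?N ?p"
      unfolding is_vfunctor_def
    proof (intro conjI ballI)
      show "?p \<in> obj (Hom M C Y) \<rightarrow> obj ?N"
        by (simp add: p obj_nat_vcat)
      fix h h' assume h: "h \<in> obj (Hom M C Y)" "h' \<in> obj (Hom M C Y)"
      show "dst (Hom M C Y) h h' \<le> dst ?N (?p h) (?p h')"
        unfolding dst_nat_vcat[OF h[THEN p]]
      proof (intro INF_greatest)
        fix a w assume aw: "a \<in> Obj K" "w \<in> obj (fobj W a)"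
        then show "dst (Hom M C Y) h h' \<le> dst (Hom M (fobj F a) Y) (?p h a w) (?p h' a w)"
          using Comp_dst_left[OF F_obj C Y cylinder_in[OF lam] h] by simp
      qed
    qed
    show "is_vfunctor ?N (Hom M C Y) g"
      unfolding is_vfunctor_def
    proof (intro conjI ballI)
      show "g \<in> obj ?N \<rightarrow> obj (Hom M C Y)"
        by (simp add: g obj_nat_vcat)
      fix \<sigma> \<tau> assume "\<sigma> \<in> obj ?N" "\<tau> \<in> obj ?N"
      then have *: "cylinder K M W F Y \<sigma>" "cylinder K M W F Y \<tau>"
        by (simp_all add: obj_nat_vcat)
      show "dst ?N \<sigma> \<tau> \<le> dst (Hom M C Y) (g \<sigma>) (g \<tau>)"
      \<comment> \<open>The bound r is here the distance between the two cylinders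
        themselves.\<close>
      proof (rule dist[OF Y])
        fix a w assume aw: "a \<in> Obj K" "w \<in> obj (fobj W a)"
        have "dst ?N \<sigma> \<tau> \<le> dst (Hom M (fobj F a) Y) (\<sigma> a w) (\<tau> a w)"
          unfolding dst_nat_vcat[OF *] by (rule INF_lower2[OF aw(1)], rule INF_lower[OF aw(2)])
        then show "dst ?N \<sigma> \<tau> \<le> dst (Hom M (fobj F a) Y)
            (Comp M (fobj F a) C Y (g \<sigma>) (lam a w)) (Comp M (fobj F a) C Y (g \<tau>) (lam a w))"
          using g[OF *(1)] g[OF *(2)] aw by simp
      qed (use g * in auto)
    qed
  next
    fix h assume h: "h \<in> obj (Hom M C Y)"
    show "g (?p h) = h"
      by (rule uniq[OF Y]) (use g[OF p[OF h]] h in auto)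
  next
    fix \<sigma> assume "\<sigma> \<in> obj ?N"
    then have \<sigma>: "cylinder K M W F Y \<sigma>"
      by (simp add: obj_nat_vcat)
    show "?p (g \<sigma>) = \<sigma>"
      by (rule cylinder_eqI[OF p \<sigma>]) (use g[OF \<sigma>] in auto)
  qed
qed

lemma wcolim_obj: "is_wcolim K M W F C lam \<Longrightarrow> C \<in> Obj M"
  by (simp add: is_wcolim_iff)

lemma wcolim_cylinder: "is_wcolim K M W F C lam \<Longrightarrow> cylinder K M W F C lam"
  by (simp add: is_wcolim_iff)

lemma wcolim_iso_obtain:
  assumes "is_wcolim K M W F C lam" "Y \<in> Obj M"
  obtains g where
    "\<And>\<sigma>. cylinder K M W F Y \<sigma> \<Longrightarrow> g \<sigma> \<in> obj (Hom M C Y)"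
    "\<And>\<sigma>. cylinder K M W F Y \<sigma> \<Longrightarrow> post K M W F C lam Y (g \<sigma>) = \<sigma>"
    "\<And>h. h \<in> obj (Hom M C Y) \<Longrightarrow> g (post K M W F C lam Y h) = h"
    "is_vfunctor (nat_vcat (op_ecat K) W (hom_into M F Y)) (Hom M C Y) g"
proof -
  have "vcat_iso (Hom M C Y) (nat_vcat (op_ecat K) W (hom_into M F Y)) (post K M W F C lam Y)"
    using assms by (simp add: is_wcolim_iff)
  then show ?thesis
    unfolding vcat_iso_def using that vfunctor_obj
    by (metis obj_nat_vcat)
qed

lemma wcolim_ex:
  assumes "is_wcolim K M W F C lam" "Y \<in> Obj M" "cylinder K M W F Y \<sigma>"
  obtains h where "h \<in> obj (Hom M C Y)"
    "\<And>a w. a \<in> Obj K \<Longrightarrow> w \<in> obj (fobj W a) \<Longrightarrow> Comp M (fobj F a) C Y h (lam a w) = \<sigma> a w"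
  using wcolim_iso_obtain[OF assms(1,2)] assms(3) by (metis post_apply)

lemma wcolim_uniq:
  assumes "is_wcolim K M W F C lam" "Y \<in> Obj M" "h \<in> obj (Hom M C Y)" "h' \<in> obj (Hom M C Y)"
    and "\<And>a w. a \<in> Obj K \<Longrightarrow> w \<in> obj (fobj W a) \<Longrightarrow>
        Comp M (fobj F a) C Y h (lam a w) = Comp M (fobj F a) C Y h' (lam a w)"
  shows "h = h'"
proof -
  have "post K M W F C lam Y h = post K M W F C lam Y h'"
    using assms(5) by (auto simp: post_def restrict_def fun_eq_iff)
  then show ?thesis
    using wcolim_iso_obtain[OF assms(1,2)] assms(3,4) by metis
qed

lemma wcolim_dist:
  assumes C: "is_wcolim K M W F C lam" and Y: "Y \<in> Obj M"
    and h: "h \<in> obj (Hom M C Y)" "h' \<in> obj (Hom M C Y)"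
    and r: "\<And>a w. a \<in> Obj K \<Longrightarrow> w \<in> obj (fobj W a) \<Longrightarrow>
        r \<le> dst (Hom M (fobj F a) Y)
          (Comp M (fobj F a) C Y h (lam a w)) (Comp M (fobj F a) C Y h' (lam a w))"
  shows "r \<le> dst (Hom M C Y) h h'"
proof -
  let ?N = "nat_vcat (op_ecat K) W (hom_into M F Y)" and ?p = "post K M W F C lam Y"
  obtain g where g: "\<And>h. h \<in> obj (Hom M C Y) \<Longrightarrow> g (?p h) = h" "is_vfunctor ?N (Hom M C Y) g"
    using wcolim_iso_obtain[OF C Y] by metis
  have p: "cylinder K M W F Y (?p h)" if "h \<in> obj (Hom M C Y)" for h
    by (rule cylinder_post[OF wcolim_obj[OF C] Y wcolim_cylinder[OF C] that])
  have "r \<le> dst ?N (?p h) (?p h')"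
    unfolding dst_nat_vcat[OF h[THEN p]] by (intro INF_greatest) (simp add: r)
  also have "\<dots> \<le> dst (Hom M C Y) (g (?p h)) (g (?p h'))"
    by (rule vfunctor_dst[OF g(2)]) (simp_all add: obj_nat_vcat p h)
  finally show ?thesis using g(1) h by simp
qed

text \<open>Each universal cylinder induces an arrow to the other colimit; both composites agree
  with the identity on a universal cylinder and hence are identities.\<close>

lemma wcolim_unique:
  assumes C: "is_wcolim K M W F C lam" and C': "is_wcolim K M W F C' lam'"
  obtains u where "is_iso_in M C C' u"
    "\<And>a w. a \<in> Obj K \<Longrightarrow> w \<in> obj (fobj W a) \<Longrightarrow> Comp M (fobj F a) C C' u (lam a w) = lam' a w"
proof -
  note O = wcolim_obj[OF C] wcolim_obj[OF C'] F_obj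
  note L = cylinder_in[OF wcolim_cylinder[OF C]] cylinder_in[OF wcolim_cylinder[OF C']]
  obtain u where u: "u \<in> obj (Hom M C C')"
    "\<And>a w. a \<in> Obj K \<Longrightarrow> w \<in> obj (fobj W a) \<Longrightarrow> Comp M (fobj F a) C C' u (lam a w) = lam' a w"
    using wcolim_ex[OF C O(2) wcolim_cylinder[OF C']] by metis
  obtain v where v: "v \<in> obj (Hom M C' C)"
    "\<And>a w. a \<in> Obj K \<Longrightarrow> w \<in> obj (fobj W a) \<Longrightarrow> Comp M (fobj F a) C' C v (lam' a w) = lam a w"
    using wcolim_ex[OF C' O(1) wcolim_cylinder[OF C]] by metis
  have "Comp M C C' C v u = Id M C"
    by (rule wcolim_uniq[OF C O(1)]) (simp_all add: O L u v Comp_in Id_in Id_Comp Comp_assoc[of _ C C' C])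
  moreover have "Comp M C' C C' u v = Id M C'"
    by (rule wcolim_uniq[OF C' O(2)]) (simp_all add: O L u v Comp_in Id_in Id_Comp Comp_assoc[of _ C' C C'])
  ultimately have "is_iso_in M C C' u"
    using u v by (auto simp: is_iso_in_def)
  then show ?thesis using u(2) that by blast
qed

text \<open>Precomposition with u identifies arrows out of C' with arrows out of C. Distances are
  reflected because precomposition with the inverse v returns h, and precomposition can only raise
  the value of \<open>dst\<close>.\<close>

lemma wcolim_iso:
  assumes C: "is_wcolim K M W F C lam" and C': "C' \<in> Obj M" and u: "is_iso_in M C C' u"
  shows "is_wcolim K M W F C' (post K M W F C lam C' u)"
proof -
  note O = wcolim_obj[OF C] C' F_obj
  note L = cylinder_in[OF wcolim_cylinder[OF C]]
  obtain v where v: "v \<in> obj (Hom M C' C)" "Comp M C C' C v u = Id M C" "Comp M C' C C' u v = Id M C'"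
    and u: "u \<in> obj (Hom M C C')"
    using u by (auto simp: is_iso_in_def)
  have huv: "Comp M C' C Y (Comp M C C' Y h u) v = h"
    if "Y \<in> Obj M" "h \<in> obj (Hom M C' Y)" for Y h
    using that by (simp add: O u v Comp_assoc[of _ C C' Y] Comp_Id)
  have assoc: "Comp M (fobj F a) C' Y h (Comp M (fobj F a) C C' u (lam a w)) =
      Comp M (fobj F a) C Y (Comp M C C' Y h u) (lam a w)"
    if "Y \<in> Obj M" "h \<in> obj (Hom M C' Y)" "a \<in> Obj K" "w \<in> obj (fobj W a)" for Y h a w
    using that by (simp add: O u L Comp_assoc[of _ C C' Y])
  show ?thesis
  proof (rule wcolimI[OF C' cylinder_post[OF O(1) C' wcolim_cylinder[OF C] u]])
    fix Y \<sigma> assume Y: "Y \<in> Obj M" and \<sigma>: "cylinder K M W F Y \<sigma>"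
    obtain h where h: "h \<in> obj (Hom M C Y)"
      "\<And>a w. a \<in> Obj K \<Longrightarrow> w \<in> obj (fobj W a) \<Longrightarrow> Comp M (fobj F a) C Y h (lam a w) = \<sigma> a w"
      using wcolim_ex[OF C Y \<sigma>] by metis
    have "Comp M C C' Y (Comp M C' C Y h v) u = h"
      using h Y by (simp add: O u v Comp_assoc[of _ C' C Y] Comp_Id)
    then show "\<exists>h\<in>obj (Hom M C' Y). \<forall>a\<in>Obj K. \<forall>w\<in>obj (fobj W a).
        Comp M (fobj F a) C' Y h (post K M W F C lam C' u a w) = \<sigma> a w"
      using h Y v by (intro bexI[of _ "Comp M C' C Y h v"]) (simp_all add: assoc O Comp_in)
  next
    fix Y h h' assume *: "Y \<in> Obj M" "h \<in> obj (Hom M C' Y)" "h' \<in> obj (Hom M C' Y)"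
      "\<And>a w. a \<in> Obj K \<Longrightarrow> w \<in> obj (fobj W a) \<Longrightarrow>
        Comp M (fobj F a) C' Y h (post K M W F C lam C' u a w) =
        Comp M (fobj F a) C' Y h' (post K M W F C lam C' u a w)"
    have "Comp M C C' Y h u = Comp M C C' Y h' u"
      by (rule wcolim_uniq[OF C *(1)]) (use * in \<open>auto simp: assoc O u Comp_in\<close>)
    then show "h = h'"
      using huv * by metis
  next
    fix Y h h' r assume *: "Y \<in> Obj M" "h \<in> obj (Hom M C' Y)" "h' \<in> obj (Hom M C' Y)"
      "\<And>a w. a \<in> Obj K \<Longrightarrow> w \<in> obj (fobj W a) \<Longrightarrow> r \<le> dst (Hom M (fobj F a) Y)
        (Comp M (fobj F a) C' Y h (post K M W F C lam C' u a w))
        (Comp M (fobj F a) C' Y h' (post K M W F C lam C' u a w))"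
    have "r \<le> dst (Hom M C Y) (Comp M C C' Y h u) (Comp M C C' Y h' u)"
      by (rule wcolim_dist[OF C *(1)]) (use * in \<open>auto simp: assoc O u Comp_in\<close>)
    also have "\<dots> \<le> dst (Hom M C' Y) (Comp M C' C Y (Comp M C C' Y h u) v)
        (Comp M C' C Y (Comp M C C' Y h' u) v)"
      using * by (intro Comp_dst_left O v(1) Comp_in u)
    finally show "r \<le> dst (Hom M C' Y) h h'"
      using huv * by simp
  qed
qed

end

lemma functor_comp_simps [simp]:
  "fobj (functor_comp G F) a = fobj G (fobj F a)"
  "farr (functor_comp G F) a b k = farr G (fobj F a) (fobj F b) (farr F a b k)"
  by (simp_all add: functor_comp_def)

lemma efunctor_iso:
  assumes G: "is_efunctor K L G" and K: "a \<in> Obj K" "b \<in> Obj K" and f: "is_iso_in K a b f"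
  shows "is_iso_in L (fobj G a) (fobj G b) (farr G a b f)"
proof -
  obtain g where f: "f \<in> obj (Hom K a b)" and g: "g \<in> obj (Hom K b a)"
    "Comp K a b a g f = Id K a" "Comp K b a b f g = Id K b"
    using f by (auto simp: is_iso_in_def)
  have "Comp L (fobj G a) (fobj G b) (fobj G a) (farr G b a g) (farr G a b f) = Id L (fobj G a)"
    "Comp L (fobj G b) (fobj G a) (fobj G b) (farr G a b f) (farr G b a g) = Id L (fobj G b)"
    using efunctor_Comp[OF G K(1,2,1) f g(1)] efunctor_Comp[OF G K(2,1,2) g(1) f]
    by (simp_all add: g efunctor_Id[OF G] K)
  then show ?thesis
    using efunctor_arr[OF G] K f g(1) unfolding is_iso_in_def by blast
qed

lemma weighted_diagram_hom_into:
  assumes M: "is_ecat M" and F: "is_efunctor K M F"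
    and L: "is_ecat L" and J: "is_efunctor K L J" and X: "X \<in> Obj L"
  shows "weighted_diagram M K (hom_into L J X) F"
proof -
  interpret L: ecat L by standard (rule L)
  show ?thesis
    using M F by unfold_locales (simp_all add: L.Comp_in efunctor_obj[OF J] efunctor_arr[OF J] X)
qed

text \<open>Turns "isomorphic to a Kan extension" into "is a Kan extension". The universal cylinders
  at F X are carried to G X by the inverses of the given components, and naturality of these
  inverses keeps the cylinders natural in X.\<close>

lemma is_lan_iso:
  assumes lan: "is_lan A M L J H F" and iso: "efunctors_iso M L G F" and G: "is_efunctor M L G"
    and M: "is_ecat M" and L: "is_ecat L" and J: "is_efunctor A M J" and H: "is_efunctor A L H"
  shows "is_lan A M L J H G"
proof -
  interpret L: ecat L by standard (rule L)
  interpret M: ecat M by standard (rule M)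
  obtain lam where F: "is_efunctor M L F"
    and lam: "\<And>X. X \<in> Obj M \<Longrightarrow> is_wcolim A L (hom_into M J X) H (fobj F X) (lam X)"
    and nat: "\<And>X X' g a f. \<lbrakk>X \<in> Obj M; X' \<in> Obj M; g \<in> obj (Hom M X X'); a \<in> Obj A;
      f \<in> obj (Hom M (fobj J a) X)\<rbrakk> \<Longrightarrow>
        Comp L (fobj H a) (fobj F X) (fobj F X') (farr F X X' g) (lam X a f) =
        lam X' a (Comp M (fobj J a) X X' g f)"
    using lan unfolding is_lan_def by blast
  obtain \<alpha> where \<alpha>: "\<And>X. X \<in> Obj M \<Longrightarrow> is_iso_in L (fobj G X) (fobj F X) (\<alpha> X)"
    and \<alpha>_nat: "\<And>X X' g. \<lbrakk>X \<in> Obj M; X' \<in> Obj M; g \<in> obj (Hom M X X')\<rbrakk> \<Longrightarrow>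
        Comp L (fobj G X) (fobj G X') (fobj F X') (\<alpha> X') (farr G X X' g) =
        Comp L (fobj G X) (fobj F X) (fobj F X') (farr F X X' g) (\<alpha> X)"
    using iso unfolding efunctors_iso_def by blast
  define \<beta> where "\<beta> X = (SOME g. g \<in> obj (Hom L (fobj F X) (fobj G X)) \<and>
      Comp L (fobj G X) (fobj F X) (fobj G X) g (\<alpha> X) = Id L (fobj G X) \<and>
      Comp L (fobj F X) (fobj G X) (fobj F X) (\<alpha> X) g = Id L (fobj F X))" for X
  have \<beta>: "\<beta> X \<in> obj (Hom L (fobj F X) (fobj G X)) \<and>
      Comp L (fobj G X) (fobj F X) (fobj G X) (\<beta> X) (\<alpha> X) = Id L (fobj G X) \<and>
      Comp L (fobj F X) (fobj G X) (fobj F X) (\<alpha> X) (\<beta> X) = Id L (fobj F X)"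
    if "X \<in> Obj M" for X
    unfolding \<beta>_def by (rule someI_ex) (use \<alpha>[OF that] in \<open>auto simp: is_iso_in_def\<close>)
  have \<alpha>': "\<alpha> X \<in> obj (Hom L (fobj G X) (fobj F X))" if "X \<in> Obj M" for X
    using \<alpha>[OF that] by (auto simp: is_iso_in_def)
  have iso\<beta>: "is_iso_in L (fobj F X) (fobj G X) (\<beta> X)" if "X \<in> Obj M" for X
    using \<beta>[OF that] \<alpha>'[OF that] by (auto simp: is_iso_in_def)
  note O = efunctor_obj[OF F] efunctor_obj[OF G] efunctor_obj[OF H] efunctor_obj[OF J]
    efunctor_arr[OF F] efunctor_arr[OF G]
  have \<beta>_nat: "Comp L (fobj F X) (fobj G X) (fobj G X') (farr G X X' g) (\<beta> X) =
      Comp L (fobj F X) (fobj F X') (fobj G X') (\<beta> X') (farr F X X' g)"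
    if *: "X \<in> Obj M" "X' \<in> Obj M" "g \<in> obj (Hom M X X')" for X X' g
  proof -
    let ?C = "Comp L"
    \<comment> \<open>The identity \<open>\<beta> X' \<circ> \<alpha> X'\<close> is inserted after G
      g; naturality of \<alpha> then replaces G g by F g, and \<alpha> X cancels against \<beta>
      X.\<close>
    have "?C (fobj F X) (fobj G X) (fobj G X') (farr G X X' g) (\<beta> X) =
        ?C (fobj F X) (fobj G X) (fobj G X') (?C (fobj G X) (fobj F X') (fobj G X') (\<beta> X')
          (?C (fobj G X) (fobj G X') (fobj F X') (\<alpha> X') (farr G X X' g))) (\<beta> X)"
      using * by (subst L.Comp_assoc[of "fobj G X" "fobj G X'" "fobj F X'" "fobj G X'", symmetric])
        (simp_all add: O \<alpha>' \<beta> L.Id_Comp)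
    also have "\<dots> = ?C (fobj F X) (fobj F X') (fobj G X') (\<beta> X')
        (?C (fobj F X) (fobj G X) (fobj F X')
          (?C (fobj G X) (fobj F X) (fobj F X') (farr F X X' g) (\<alpha> X)) (\<beta> X))"
      unfolding \<alpha>_nat[OF *] using *
      by (intro L.Comp_assoc) (simp_all add: O \<alpha>' \<beta> L.Comp_in)
    also have "\<dots> = ?C (fobj F X) (fobj F X') (fobj G X') (\<beta> X') (farr F X X' g)"
      using * by (simp add: O \<alpha>' \<beta> L.Comp_assoc[of "fobj F X" "fobj G X" "fobj F X"] L.Comp_Id)
    finally show ?thesis .
  qed
  have wd: "weighted_diagram L A (hom_into M J X) H" if "X \<in> Obj M" for X
    by (rule weighted_diagram_hom_into[OF L H M J that])
  let ?lam = "\<lambda>X. post A L (hom_into M J X) H (fobj F X) (lam X) (fobj G X) (\<beta> X)"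
  have "is_wcolim A L (hom_into M J X) H (fobj G X) (?lam X)" if "X \<in> Obj M" for X
    using that by (intro weighted_diagram.wcolim_iso[OF wd] lam iso\<beta> O)
  moreover have "Comp L (fobj H a) (fobj G X) (fobj G X') (farr G X X' g) (?lam X a f) =
        ?lam X' a (Comp M (fobj J a) X X' g f)"
    if *: "X \<in> Obj M" "X' \<in> Obj M" "g \<in> obj (Hom M X X')" "a \<in> Obj A"
      "f \<in> obj (Hom M (fobj J a) X)" for X X' g a f
  proof -
    have l: "lam X a f \<in> obj (Hom L (fobj H a) (fobj F X))"
      using cylinder_in[OF weighted_diagram.wcolim_cylinder[OF wd lam]] * by simp
    have "Comp L (fobj H a) (fobj G X) (fobj G X') (farr G X X' g) (?lam X a f) =
        Comp L (fobj H a) (fobj F X) (fobj G X')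
          (Comp L (fobj F X) (fobj G X) (fobj G X') (farr G X X' g) (\<beta> X)) (lam X a f)"
      using * l by (simp add: L.Comp_assoc[of "fobj H a" "fobj F X" "fobj G X"] O \<beta>)
    also have "\<dots> = Comp L (fobj H a) (fobj F X') (fobj G X') (\<beta> X')
        (Comp L (fobj H a) (fobj F X) (fobj F X') (farr F X X' g) (lam X a f))"
      unfolding \<beta>_nat[OF *(1-3)] using * l by (intro L.Comp_assoc) (simp_all add: O \<beta>)
    also have "\<dots> = ?lam X' a (Comp M (fobj J a) X X' g f)"
      using * by (simp add: nat O M.Comp_in)
    finally show ?thesis .
  qed
  ultimately show ?thesis
    unfolding is_lan_def using G by (intro conjI exI[of _ ?lam] ballI) blast+
qed


section \<open>Colimits weighted by \<open>N\<close>\<close>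

lemma free_ecat_simps [simp]:
  "Obj (free_ecat C) = Ob C"
  "Hom (free_ecat C) a b = discrete_vcat (Ar C a b)"
  "Comp (free_ecat C) = cmp C"
  "Id (free_ecat C) = idn C"
  by (simp_all add: free_ecat_def)

lemma obj_discrete_vcat [simp]: "obj (discrete_vcat A) = A"
  by (simp add: discrete_vcat_def)

lemma dst_discrete_vcat:
  "dst (discrete_vcat A) x y = (if x \<in> A \<and> x = y then 1 else bot)"
  by (auto simp: discrete_vcat_def dst_mk_vcat)

lemma is_vcat_discrete_vcat: "is_vcat (discrete_vcat A)"
  by (simp add: is_vcat_def dst_discrete_vcat)

lemma is_vfunctor_discrete_vcat:
  "is_vcat Y \<Longrightarrow> is_vfunctor (discrete_vcat A) Y f \<longleftrightarrow> f \<in> A \<rightarrow> obj Y"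
  by (auto simp: is_vfunctor_def dst_discrete_vcat Pi_iff vcat_refl)

lemma obj_ihom_discrete_vcat: "is_vcat Y \<Longrightarrow> obj (ihom (discrete_vcat A) Y) = A \<rightarrow>\<^sub>E obj Y"
  by (auto simp: obj_ihom is_vfunctor_discrete_vcat PiE_def)

lemma Ncat_simps [simp]:
  "Ob Ncat = UNIV"
  "Ar Ncat a b = (if a = b then {Idn} else if a \<noteq> None \<and> b = None then {Del0, Del1} else {})"
  "cmp Ncat a b c g f = (if f = Idn then g else f)"
  "idn Ncat a = Idn"
  by (simp_all add: Ncat_def)

lemma fobj_Nwt [simp]: "fobj Nwt None = unit_vcat" "fobj Nwt (Some r) = two_vcat r"
  by (simp_all add: Nwt_def Let_def)

lemma farr_Nwt: "i \<in> obj (fobj Nwt a) \<Longrightarrow>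
    farr Nwt a b k i = (case k of Idn \<Rightarrow> i | Del0 \<Rightarrow> 0 | Del1 \<Rightarrow> 1)"
  by (simp add: Nwt_def Let_def)

lemma obj_unit_vcat [simp]: "obj unit_vcat = {0}"
  by (simp add: unit_vcat_def)

lemma obj_two_vcat [simp]: "obj (two_vcat r) = {0, 1}"
  by (simp add: two_vcat_def)

lemma dst_unit_vcat [simp]: "dst unit_vcat 0 0 = 1"
  by (simp add: unit_vcat_def dst_mk_vcat)

lemma dst_two_vcat [simp]:
  "dst (two_vcat r) 0 0 = 1" "dst (two_vcat r) (Suc 0) (Suc 0) = 1"
  "dst (two_vcat r) 0 (Suc 0) = r" "dst (two_vcat r) (Suc 0) 0 = bot"
  by (simp_all add: two_vcat_def dst_mk_vcat)

lemma weighted_diagram_Nwt: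
  assumes "is_ecat M" "is_efunctor Nv M F"
  shows "weighted_diagram M Nv Nwt F"
  using assms
  by unfold_locales (auto simp: farr_Nwt split: if_splits)

text \<open>
  A cylinder over \<open>N\<close> is determined by its component \<open>s\<close> at the unit enriched category: naturality
  forces the other components to be composites with the two projections, and functoriality on
  \<open>two_vcat r\<close> becomes an inequality.
\<close>

definition N_leg ::
    "('d, 'n, 'v::comm_quantale) ecat \<Rightarrow> ('v option, narr, 'd, 'n) fctr \<Rightarrow> 'd \<Rightarrow> 'n \<Rightarrow> bool" where
  "N_leg M F Y s \<longleftrightarrow> s \<in> obj (Hom M (fobj F None) Y) \<and>
     (\<forall>r. r \<le> dst (Hom M (fobj F (Some r)) Y)
       (Comp M (fobj F (Some r)) (fobj F None) Y s (farr F (Some r) None Del0))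
       (Comp M (fobj F (Some r)) (fobj F None) Y s (farr F (Some r) None Del1)))"

text \<open>The cylinder generated by a leg s. Every element of the option type is an object of
  \<open>Nv\<close>, so extensionality in the index a holds without a restriction.\<close>

definition N_cyl ::
    "('d, 'n, 'v::comm_quantale) ecat \<Rightarrow> ('v option, narr, 'd, 'n) fctr \<Rightarrow> 'd \<Rightarrow> 'n \<Rightarrow>
     'v option \<Rightarrow> nat \<Rightarrow> 'n" where
  "N_cyl M F Y s = (\<lambda>a. \<lambda>i\<in>obj (fobj Nwt a). case a of None \<Rightarrow> s
     | Some r \<Rightarrow> Comp M (fobj F (Some r)) (fobj F None) Y s
         (farr F (Some r) None (if i = 0 then Del0 else Del1)))"

text \<open>The universal property of \<open>N * F\<close> in terms of legs. Uniqueness and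
  distances are tested on q alone, because the other components of the cylinder are composites of q
  with the images of the two projections; the reverse inequality of distances is functoriality of
  composition.\<close>

definition is_N_colim ::
    "('d, 'n, 'v::comm_quantale) ecat \<Rightarrow> ('v option, narr, 'd, 'n) fctr \<Rightarrow> 'd \<Rightarrow> 'n \<Rightarrow> bool" where
  "is_N_colim M F C q \<longleftrightarrow> C \<in> Obj M \<and> N_leg M F C q \<and>
     (\<forall>Y\<in>Obj M. \<forall>s. N_leg M F Y s \<longrightarrow>
       (\<exists>h\<in>obj (Hom M C Y). Comp M (fobj F None) C Y h q = s)) \<and>
     (\<forall>Y\<in>Obj M. \<forall>h\<in>obj (Hom M C Y). \<forall>h'\<in>obj (Hom M C Y).
       (Comp M (fobj F None) C Y h q = Comp M (fobj F None) C Y h' q \<longrightarrow> h = h') \<and>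
       dst (Hom M (fobj F None) Y) (Comp M (fobj F None) C Y h q) (Comp M (fobj F None) C Y h' q)
         \<le> dst (Hom M C Y) h h')"

lemma N_colim_ex:
  assumes "is_N_colim M F C q" "Y \<in> Obj M" "N_leg M F Y s"
  obtains h where "h \<in> obj (Hom M C Y)" "Comp M (fobj F None) C Y h q = s"
  using assms unfolding is_N_colim_def by blast

locale N_diagram = ecat M for M :: "('d, 'n, 'v::comm_quantale) ecat" +
  fixes F :: "('v option, narr, 'd, 'n) fctr"
  assumes F: "is_efunctor Nv M F"
begin

sublocale weighted_diagram M Nv Nwt F
  by (rule weighted_diagram_Nwt[OF ecat F])

lemma fobj_in [simp]: "fobj F a \<in> Obj M"
  using F_obj[of a] by simp

lemma farr_Del_in [simp]:
  "farr F (Some r) None Del0 \<in> obj (Hom M (fobj F (Some r)) (fobj F None))"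
  "farr F (Some r) None Del1 \<in> obj (Hom M (fobj F (Some r)) (fobj F None))"
  using F_arr[of "Some r" None] by simp_all

lemma farr_Idn [simp]: "farr F a a Idn = Id M (fobj F a)"
  using efunctor_Id[OF F, of a] by simp

text \<open>In \<open>two_vcat r\<close> the distance from 0 to 1 is r, which is exactly what
  \<open>N_leg\<close> bounds. The distance back is bot, and the self-distances 1 are covered by
  reflexivity.\<close>

lemma cylinder_N_cyl:
  assumes Y: "Y \<in> Obj M" and s: "N_leg M F Y s"
  shows "cylinder Nv M Nwt F Y (N_cyl M F Y s)"
proof (rule cylinderI)
  have in_Y: "s \<in> obj (Hom M (fobj F None) Y)"
    using s by (simp add: N_leg_def)
  show "N_cyl M F Y s a w \<in> obj (Hom M (fobj F a) Y)" if "w \<in> obj (fobj Nwt a)" for a w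
    using that in_Y Y by (auto simp: N_cyl_def Comp_in split: option.splits)
  show "dst (fobj Nwt a) w w' \<le> dst (Hom M (fobj F a) Y) (N_cyl M F Y s a w) (N_cyl M F Y s a w')"
    if "w \<in> obj (fobj Nwt a)" "w' \<in> obj (fobj Nwt a)" for a w w'
    using that in_Y Y s
    by (cases a) (auto simp: N_cyl_def N_leg_def intro!: vcat_refl is_vcat_Hom Comp_in)
  show "Comp M (fobj F b) (fobj F a) Y (N_cyl M F Y s a w) (farr F b a k) =
      N_cyl M F Y s b (farr Nwt a b k w)"
    if "k \<in> obj (Hom Nv b a)" "w \<in> obj (fobj Nwt a)" for a b k w
    using that in_Y Y
    by (cases a; cases b) (auto simp: N_cyl_def farr_Nwt Comp_Id Comp_in split: if_splits)
qed (simp_all add: N_cyl_def)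

text \<open>Naturality along \<open>Del0\<close> and \<open>Del1\<close>, evaluated at the single
  object 0 of the unit enriched category, expresses both values at \<open>Some r\<close> through
  \<open>\<sigma> None 0\<close>.\<close>

lemma N_cyl_cylinder:
  assumes Y: "Y \<in> Obj M" and \<sigma>: "cylinder Nv M Nwt F Y \<sigma>"
  shows "N_leg M F Y (\<sigma> None 0)" "\<sigma> = N_cyl M F Y (\<sigma> None 0)"
proof -
  have 0: "\<sigma> (Some r) 0 =
      Comp M (fobj F (Some r)) (fobj F None) Y (\<sigma> None 0) (farr F (Some r) None Del0)"
    and 1: "\<sigma> (Some r) 1 =
      Comp M (fobj F (Some r)) (fobj F None) Y (\<sigma> None 0) (farr F (Some r) None Del1)" for r
    using cylinder_natural[OF \<sigma>, of None "Some r" Del0 0]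
      cylinder_natural[OF \<sigma>, of None "Some r" Del1 0] by (simp_all add: farr_Nwt)
  show leg: "N_leg M F Y (\<sigma> None 0)"
    unfolding N_leg_def 0[symmetric] 1[symmetric]
    using cylinder_in[OF \<sigma>, of None 0] cylinder_dst[OF \<sigma>, of "Some _" 0 1] by simp
  show "\<sigma> = N_cyl M F Y (\<sigma> None 0)"
  proof (rule cylinder_eqI[OF \<sigma> cylinder_N_cyl[OF Y leg]])
    fix a :: "'v option" and w assume "w \<in> obj (fobj Nwt a)"
    then show "\<sigma> a w = N_cyl M F Y (\<sigma> None 0) a w"
      using 0 1 by (cases a) (auto simp: N_cyl_def)
  qed
qed

lemma Comp_N_cyl:
  assumes "C \<in> Obj M" "Y \<in> Obj M" "s \<in> obj (Hom M (fobj F None) C)" "h \<in> obj (Hom M C Y)"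
    and "w \<in> obj (fobj Nwt a)"
  shows "Comp M (fobj F a) C Y h (N_cyl M F C s a w) =
    N_cyl M F Y (Comp M (fobj F None) C Y h s) a w"
  using assms by (cases a) (auto simp: N_cyl_def Comp_assoc[of _ "fobj F None" C Y])

lemma N_cyl_None [simp]: "N_cyl M F Y s None 0 = s"
  by (simp add: N_cyl_def)

lemma N_colim_imp_wcolim:
  assumes q: "is_N_colim M F C q"
  shows "is_wcolim Nv M Nwt F C (N_cyl M F C q)"
proof -
  have C: "C \<in> Obj M" and leg: "N_leg M F C q"
    using q by (simp_all add: is_N_colim_def)
  then have in_C: "q \<in> obj (Hom M (fobj F None) C)"
    by (simp add: N_leg_def)
  show ?thesis
  proof (rule wcolimI[OF C cylinder_N_cyl[OF C leg]])
    fix Y \<sigma> assume Y: "Y \<in> Obj M" and \<sigma>: "cylinder Nv M Nwt F Y \<sigma>"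
    obtain h where h: "h \<in> obj (Hom M C Y)" "Comp M (fobj F None) C Y h q = \<sigma> None 0"
      using N_colim_ex[OF q Y N_cyl_cylinder(1)[OF Y \<sigma>]] .
    have "Comp M (fobj F a) C Y h (N_cyl M F C q a w) = \<sigma> a w" if "w \<in> obj (fobj Nwt a)" for a w
      using Comp_N_cyl[OF C Y in_C h(1) that] N_cyl_cylinder(2)[OF Y \<sigma>] h(2) by metis
    then show "\<exists>h\<in>obj (Hom M C Y). \<forall>a\<in>Obj Nv. \<forall>w\<in>obj (fobj Nwt a).
        Comp M (fobj F a) C Y h (N_cyl M F C q a w) = \<sigma> a w"
      using h(1) by blast
  next
    fix Y h h' assume Y: "Y \<in> Obj M" "h \<in> obj (Hom M C Y)" "h' \<in> obj (Hom M C Y)"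
      and *: "\<And>a w. a \<in> Obj Nv \<Longrightarrow> w \<in> obj (fobj Nwt a) \<Longrightarrow>
        Comp M (fobj F a) C Y h (N_cyl M F C q a w) = Comp M (fobj F a) C Y h' (N_cyl M F C q a w)"
    show "h = h'"
      using q Y *[of None 0] by (simp add: is_N_colim_def)
  next
    fix Y h h' r assume Y: "Y \<in> Obj M" "h \<in> obj (Hom M C Y)" "h' \<in> obj (Hom M C Y)"
      and *: "\<And>a w. a \<in> Obj Nv \<Longrightarrow> w \<in> obj (fobj Nwt a) \<Longrightarrow> r \<le> dst (Hom M (fobj F a) Y)
        (Comp M (fobj F a) C Y h (N_cyl M F C q a w)) (Comp M (fobj F a) C Y h' (N_cyl M F C q a w))"
    show "r \<le> dst (Hom M C Y) h h'"
      using q Y *[of None 0] by (auto simp: is_N_colim_def intro: order_trans)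
  qed
qed

lemma wcolim_imp_N_colim:
  assumes C: "is_wcolim Nv M Nwt F C (N_cyl M F C q)"
  shows "is_N_colim M F C q"
  unfolding is_N_colim_def
proof (intro conjI ballI allI impI)
  note O = wcolim_obj[OF C]
  show "C \<in> Obj M" by (rule O)
  show leg: "N_leg M F C q"
    using N_cyl_cylinder(1)[OF O wcolim_cylinder[OF C]] by simp
  then have in_C: "q \<in> obj (Hom M (fobj F None) C)"
    by (simp add: N_leg_def)
  show "\<exists>h\<in>obj (Hom M C Y). Comp M (fobj F None) C Y h q = s"
    if Y: "Y \<in> Obj M" and s: "N_leg M F Y s" for Y s
  proof -
    obtain h where h: "h \<in> obj (Hom M C Y)" "\<And>a w. a \<in> Obj Nv \<Longrightarrow> w \<in> obj (fobj Nwt a) \<Longrightarrow>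
        Comp M (fobj F a) C Y h (N_cyl M F C q a w) = N_cyl M F Y s a w"
      using wcolim_ex[OF C Y cylinder_N_cyl[OF Y s]] by metis
    then show ?thesis
      using h(2)[of None 0] by auto
  qed
  fix Y h h' assume *: "Y \<in> Obj M" "h \<in> obj (Hom M C Y)" "h' \<in> obj (Hom M C Y)"
  note N = Comp_N_cyl[OF O *(1) in_C *(2)] Comp_N_cyl[OF O *(1) in_C *(3)]
  show "h = h'" if "Comp M (fobj F None) C Y h q = Comp M (fobj F None) C Y h' q"
    by (rule wcolim_uniq[OF C *]) (simp add: N that)
  show "dst (Hom M (fobj F None) Y) (Comp M (fobj F None) C Y h q) (Comp M (fobj F None) C Y h' q)
      \<le> dst (Hom M C Y) h h'" (is "?r \<le> _")
  proof (rule wcolim_dist[OF C *])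
    fix a :: "'v option" and w assume w: "w \<in> obj (fobj Nwt a)"
    have hq: "Comp M (fobj F None) C Y h q \<in> obj (Hom M (fobj F None) Y)"
      "Comp M (fobj F None) C Y h' q \<in> obj (Hom M (fobj F None) Y)"
      using * O in_C by (simp_all add: Comp_in)
    show "?r \<le> dst (Hom M (fobj F a) Y) (Comp M (fobj F a) C Y h (N_cyl M F C q a w))
        (Comp M (fobj F a) C Y h' (N_cyl M F C q a w))"
      \<comment> \<open>At \<open>Some r\<close> both arrows are precomposed with the same
        projection, which can only raise \<open>dst\<close>.\<close>
      unfolding N[OF w]
      using w hq * by (cases a) (auto simp: N_cyl_def intro!: Comp_dst_left)
  qed
qed

end

section \<open>Enriched functors applied to colimits weighted by N\<close>

lemma N_leg_efunctor:
  assumes M: "is_ecat M" and F: "is_efunctor Nv M F" and G: "is_efunctor M L G"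
    and C: "C \<in> Obj M" and q: "N_leg M F C q"
  shows "N_leg L (functor_comp G F) (fobj G C) (farr G (fobj F None) C q)"
proof -
  interpret N_diagram M F using M F by unfold_locales
  have q_in: "q \<in> obj (Hom M (fobj F None) C)"
    using q by (simp add: N_leg_def)
  \<comment> \<open>G is a V-functor on homs, so the lower bound r survives; compatibility with
    composition then puts it into the form of a leg for the composite diagram.\<close>
  have "r \<le> dst (Hom L (fobj G (fobj F (Some r))) (fobj G C))
      (farr G (fobj F (Some r)) C
        (Comp M (fobj F (Some r)) (fobj F None) C q (farr F (Some r) None Del0)))
      (farr G (fobj F (Some r)) C
        (Comp M (fobj F (Some r)) (fobj F None) C q (farr F (Some r) None Del1)))" for r
    using q C q_in
    by (intro order_trans[OF _ vfunctor_dst[OF efunctor_vfunctor[OF G]]])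
      (simp_all add: N_leg_def Comp_in)
  then show ?thesis
    using C q_in by (simp add: N_leg_def efunctor_arr[OF G] efunctor_Comp[OF G, of _ "fobj F None"])
qed

lemma N_cyl_efunctor:
  assumes M: "is_ecat M" and F: "is_efunctor Nv M F" and G: "is_efunctor M L G"
    and C: "C \<in> Obj M" and q: "q \<in> obj (Hom M (fobj F None) C)" and w: "w \<in> obj (fobj Nwt a)"
  shows "farr G (fobj F a) C (N_cyl M F C q a w) =
    N_cyl L (functor_comp G F) (fobj G C) (farr G (fobj F None) C q) a w"
proof -
  interpret N_diagram M F using M F by unfold_locales
  show ?thesis
    using w C q
    by (cases a) (auto simp: N_cyl_def efunctor_Comp[OF G, of _ "fobj F None"])
qed

text \<open>Preservation quantifies over all colimits of the diagram, but one representative decides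
  it: any other is isomorphic to it compatibly with the cylinders, and G carries this isomorphism to
  one along which the image colimit is transported.\<close>

lemma preserves_wcolim_Nwt_iff:
  assumes M: "is_ecat M" and L: "is_ecat L" and F: "is_efunctor Nv M F" and G: "is_efunctor M L G"
    and q: "is_N_colim M F X q"
  shows "preserves_wcolim Nv M L Nwt F G \<longleftrightarrow>
    is_N_colim L (functor_comp G F) (fobj G X) (farr G (fobj F None) X q)"
proof -
  interpret M: N_diagram M F using M F by unfold_locales
  interpret L: N_diagram L "functor_comp G F"
    using L is_efunctor_comp[OF F G] by unfold_locales
  let ?img = "\<lambda>C lam. \<lambda>a\<in>Obj Nv. \<lambda>w\<in>obj (fobj Nwt a). farr G (fobj F a) C (lam a w)"
  let ?Gq = "farr G (fobj F None) X q"
  have X: "X \<in> Obj M" and q_in: "q \<in> obj (Hom M (fobj F None) X)"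
    using q by (simp_all add: is_N_colim_def N_leg_def)
  have img_q: "?img X (N_cyl M F X q) = N_cyl L (functor_comp G F) (fobj G X) ?Gq"
  proof (intro ext)
    fix a w
    show "?img X (N_cyl M F X q) a w = N_cyl L (functor_comp G F) (fobj G X) ?Gq a w"
      by (cases "w \<in> obj (fobj Nwt a)")
        (simp_all add: N_cyl_efunctor[OF M F G X q_in], simp add: N_cyl_def)
  qed
  show ?thesis
  proof
    assume "preserves_wcolim Nv M L Nwt F G"
    then have "is_wcolim Nv L Nwt (functor_comp G F) (fobj G X) (?img X (N_cyl M F X q))"
      using M.N_colim_imp_wcolim[OF q] unfolding preserves_wcolim_def by blast
    then show "is_N_colim L (functor_comp G F) (fobj G X) ?Gq"
      unfolding img_q by (rule L.wcolim_imp_N_colim)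
  next
    assume *: "is_N_colim L (functor_comp G F) (fobj G X) ?Gq"
    show "preserves_wcolim Nv M L Nwt F G"
      unfolding preserves_wcolim_def
    proof (intro allI impI)
      fix C lam assume C: "is_wcolim Nv M Nwt F C lam"
      note C_obj = M.wcolim_obj[OF C]
      obtain u where u: "is_iso_in M X C u" "\<And>a w. w \<in> obj (fobj Nwt a) \<Longrightarrow>
          Comp M (fobj F a) X C u (N_cyl M F X q a w) = lam a w"
        using M.wcolim_unique[OF M.N_colim_imp_wcolim[OF q] C]
        by (metis Ncat_simps(1) UNIV_I free_ecat_simps(1))
      have u_in: "u \<in> obj (Hom M X C)"
        using u(1) by (simp add: is_iso_in_def)
      have "post Nv L Nwt (functor_comp G F) (fobj G X)
          (N_cyl L (functor_comp G F) (fobj G X) ?Gq) (fobj G C) (farr G X C u) = ?img C lam"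
      proof (intro ext)
        fix a w
        show "post Nv L Nwt (functor_comp G F) (fobj G X)
            (N_cyl L (functor_comp G F) (fobj G X) ?Gq) (fobj G C) (farr G X C u) a w = ?img C lam a w"
        proof (cases "w \<in> obj (fobj Nwt a)")
          case True
          have in_X: "N_cyl M F X q a w \<in> obj (Hom M (fobj F a) X)"
            using cylinder_in[OF M.wcolim_cylinder[OF M.N_colim_imp_wcolim[OF q]]] True by simp
          show ?thesis
            using efunctor_Comp[OF G M.fobj_in X C_obj in_X u_in] True
            by (simp add: N_cyl_efunctor[OF M F G X q_in] u(2))
        qed (simp add: post_def)
      qed
      then show "is_wcolim Nv L Nwt (functor_comp G F) (fobj G C) (?img C lam)"
        using L.wcolim_iso[OF L.N_colim_imp_wcolim[OF *] efunctor_obj[OF G C_obj]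
            efunctor_iso[OF G X C_obj u(1)]] by simp
    qed
  qed
qed

section \<open>Sets and discrete enriched categories\<close>

lemma SET_simps [simp]:
  "Ob SET = small_sets"
  "Ar SET A B = A \<rightarrow>\<^sub>E B"
  "cmp SET A B C g f = compose A g f"
  "idn SET A = (\<lambda>x\<in>A. x)"
  by (simp_all add: SET_def)

lemma Dfun_simps [simp]: "fobj Dfun A = discrete_vcat A" "farr Dfun A B f = f"
  by (simp_all add: Dfun_def)

text \<open>Between discrete homs every function is a V-functor, since distances are 1 on the
  diagonal and bot off it.\<close>

lemma is_efunctor_free_ecat:
  assumes "is_functor C D F"
  shows "is_efunctor (free_ecat C) (free_ecat D) F"
  using assms
  by (auto simp: is_functor_def is_efunctor_def is_vfunctor_def dst_discrete_vcat)

lemma discrete_in_VCAT [simp]: "A \<in> small_sets \<Longrightarrow> discrete_vcat A \<in> Obj VCAT"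
  by (simp add: VCAT_of_simps is_vcat_discrete_vcat)

lemma obj_Hom_discrete:
  "X \<in> Obj VCAT \<Longrightarrow> obj (Hom VCAT (discrete_vcat A) X) = A \<rightarrow>\<^sub>E obj X"
  by (simp add: VCAT_of_simps obj_ihom_discrete_vcat)

lemma dst_Hom_discrete_le:
  assumes "f \<in> obj (Hom VCAT (discrete_vcat A) X)" "g \<in> obj (Hom VCAT (discrete_vcat A) X)" "a \<in> A"
  shows "dst (Hom VCAT (discrete_vcat A) X) f g \<le> dst X (f a) (g a)"
  using assms by (auto simp: VCAT_of_simps dst_ihom intro: INF_lower)

lemma Comp_discrete: "Comp VCAT (discrete_vcat A) Y Z g f = compose A g f"
  by (simp add: VCAT_of_simps)

lemma Id_discrete: "Id VCAT (discrete_vcat A) = (\<lambda>x\<in>A. x)"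
  by (simp add: VCAT_of_simps)

interpretation VCAT: ecat "VCAT :: (('u, 'v::comm_quantale) vcat, _, _) ecat"
  by standard (rule is_ecat_VCAT_of)

lemma is_efunctor_Dfun:
  "is_efunctor SETv VCAT (Dfun :: ('a set, _, ('a, 'v::comm_quantale) vcat, _) fctr)"
  unfolding is_efunctor_def
proof (intro conjI ballI)
  fix A B :: "'a set" assume "A \<in> Obj SETv" "B \<in> Obj SETv"
  then show "is_vfunctor (Hom SETv A B) (Hom VCAT (fobj Dfun A) (fobj Dfun B)) (farr Dfun A B)"
    by (simp add: is_vfunctor_discrete_vcat VCAT.is_vcat_Hom obj_Hom_discrete)
qed (simp_all add: Comp_discrete Id_discrete)

section \<open>The diagrams of an enriched category and its cover by a discrete one\<close>

lemma small_pairs: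
  fixes A :: "'u set"
  assumes inf: "infinite (UNIV :: 'u set)" and A: "A \<in> small_sets" and S: "S \<subseteq> A \<times> A"
  shows "f ` S \<in> (small_sets :: 'u set set)"
proof -
  have "|f ` S| \<le>o |A \<times> A|"
    using ordLeq_transitive[OF card_of_image card_of_mono1[OF S]] .
  moreover have "|A \<times> A| <o |UNIV :: 'u set|"
  \<comment> \<open>A finite set has a finite square, which is below any infinite cardinal; an
    infinite set is equinumerous with its square.\<close>
  proof (cases "finite A")
    case True
    then have "|A \<times> A| <o natLeq"
      by (simp flip: finite_iff_ordLess_natLeq)
    then show ?thesis
      using inf infinite_iff_natLeq_ordLeq ordLess_ordLeq_trans by blast
  next
    case False
    then show ?thesis
      using card_of_Times_same_infinite[of A] A ordIso_ordLess_trans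
      by (auto simp: small_sets_def)
  qed
  ultimately show ?thesis
    by (simp add: small_sets_def ordLeq_ordLess_trans)
qed

lemma the_inv_pcode:
  assumes "infinite (UNIV :: 'u set)"
  shows "the_inv (pcode :: 'u \<times> 'u \<Rightarrow> 'u) (pcode p) = p"
  by (rule the_inv_f_f[OF inj_pcode[OF assms]])

lemma Fdiag_None [simp]: "fobj (Fdiag X) None = obj X"
  by (simp add: Fdiag_def)

lemma fobj_Fdiag_Some: "fobj (Fdiag X) (Some r) =
    pcode ` {(x', x). x' \<in> obj X \<and> x \<in> obj X \<and> r \<le> dst X x' x}"
  by (simp add: Fdiag_def)

lemma farr_Fdiag: "farr (Fdiag X) a b k = (\<lambda>p\<in>fobj (Fdiag X) a. case k of Idn \<Rightarrow> p
    | Del0 \<Rightarrow> fst (the_inv pcode p) | Del1 \<Rightarrow> snd (the_inv pcode p))"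
  by (simp add: Fdiag_def Let_def)

lemma is_functor_Fdiag:
  fixes X :: "('u, 'v::comm_quantale) vcat"
  assumes inf: "infinite (UNIV :: 'u set)" and X: "X \<in> Obj VCAT"
  shows "is_functor Ncat SET (Fdiag X)"
proof -
  have small: "obj X \<in> small_sets"
    using X by (simp add: VCAT_of_simps)
  have "fobj (Fdiag X) a \<in> small_sets" for a
  proof (cases a)
    case (Some r)
    show ?thesis unfolding Some fobj_Fdiag_Some by (rule small_pairs[OF inf small]) auto
  qed (simp add: small)
  moreover have arr: "farr (Fdiag X) a b k \<in> fobj (Fdiag X) a \<rightarrow>\<^sub>E fobj (Fdiag X) b"
    if "k \<in> Ar Ncat a b" for a b k
    using that
    by (cases a; cases b)
      (auto simp: farr_Fdiag fobj_Fdiag_Some the_inv_pcode[OF inf] split: if_splits)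
  moreover have Idn: "farr (Fdiag X) a b Idn = (\<lambda>p\<in>fobj (Fdiag X) a. p)" for a b
    by (simp add: farr_Fdiag)
  moreover have "farr (Fdiag X) a c (cmp Ncat a b c l k) =
      compose (fobj (Fdiag X) a) (farr (Fdiag X) b c l) (farr (Fdiag X) a b k)"
    if k: "k \<in> Ar Ncat a b" and l: "l \<in> Ar Ncat b c" for a b c k l
  \<comment> \<open>A non-identity arrow of the shape ends at \<open>None\<close>, and only the
    identity starts there, so one of two composable arrows is always an identity.\<close>
  proof (cases "k = Idn")
    case True
    then have "a = b" using k by (auto split: if_splits)
    then show ?thesis
      by (auto simp: True Idn compose_def fun_eq_iff) (auto simp: farr_Fdiag)
  next
    case False
    then have "b = None" using k by (auto split: if_splits)
    then have *: "l = Idn" "b = c" using l by (auto split: if_splits)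
    show ?thesis
      using PiE_mem[OF arr[OF k]] False
      by (auto simp: * Idn compose_def fun_eq_iff) (auto simp: farr_Fdiag)
  qed
  ultimately show ?thesis
    by (simp add: is_functor_def)
qed

abbreviation DF :: "('u, 'v::comm_quantale) vcat \<Rightarrow>
    ('v option, narr, ('u, 'v) vcat, 'u \<Rightarrow> 'u) fctr" where
  "DF X \<equiv> functor_comp Dfun (Fdiag X)"

text \<open>Meant as the V-functor D(obj X) -> X that is the identity on objects; the same function
  is also the identity arrow of X.\<close>

abbreviation cover :: "('u, 'v::comm_quantale) vcat \<Rightarrow> 'u \<Rightarrow> 'u" where
  "cover X \<equiv> \<lambda>x\<in>obj X. x"

lemma is_efunctor_DF:
  assumes "infinite (UNIV :: 'u set)" and "(X :: ('u, 'v::comm_quantale) vcat) \<in> Obj VCAT"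
  shows "is_efunctor Nv VCAT (DF X)"
  by (rule is_efunctor_comp[OF is_efunctor_free_ecat[OF is_functor_Fdiag] is_efunctor_Dfun])
    (use assms in auto)

lemma cover_in: "X \<in> Obj VCAT \<Longrightarrow> cover X \<in> obj (Hom VCAT (discrete_vcat (obj X)) X)"
  by (simp add: obj_Hom_discrete)

text \<open>V-functors out of a discrete category are arbitrary functions, so f is its own
  factorisation through the cover; only its codomain is read differently.\<close>

lemma lift_cover:
  assumes "X \<in> Obj VCAT" "A \<in> small_sets" "f \<in> obj (Hom VCAT (discrete_vcat A) X)"
  shows "f \<in> obj (Hom VCAT (discrete_vcat A) (discrete_vcat (obj X)))"
    and "Comp VCAT (discrete_vcat A) (discrete_vcat (obj X)) X (cover X) f = f"
  using assms
  by (auto simp: obj_Hom_discrete Comp_discrete compose_def fun_eq_iff VCAT_of_simps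
      obj_ihom_discrete_vcat is_vcat_discrete_vcat)

text \<open>Evaluated at the code of (x', x), the leg condition says that r \<le> X(x', x) implies r
  \<le> Y(s x', s x). For all r together this is V-functoriality of s, by taking r = X(x',
  x).\<close>

lemma N_leg_DF:
  fixes X :: "('u, 'v::comm_quantale) vcat"
  assumes inf: "infinite (UNIV :: 'u set)" and X: "X \<in> Obj VCAT" and Y: "Y \<in> Obj VCAT"
  shows "N_leg VCAT (DF X) Y s \<longleftrightarrow> s \<in> obj (Hom VCAT X Y)"
proof -
  have vX: "is_vcat X" and vY: "is_vcat Y"
    using X Y by (simp_all add: VCAT_of_simps)
  have *: "r \<le> dst (Hom VCAT (discrete_vcat (fobj (Fdiag X) (Some r))) Y)
      (compose (fobj (Fdiag X) (Some r)) s (farr (Fdiag X) (Some r) None Del0))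
      (compose (fobj (Fdiag X) (Some r)) s (farr (Fdiag X) (Some r) None Del1)) \<longleftrightarrow>
      (\<forall>x'\<in>obj X. \<forall>x\<in>obj X. r \<le> dst X x' x \<longrightarrow> r \<le> dst Y (s x') (s x))"
    (is "r \<le> dst _ ?f ?g \<longleftrightarrow> _") if s: "s \<in> obj X \<rightarrow>\<^sub>E obj Y" for r
  proof -
    let ?S = "fobj (Fdiag X) (Some r)"
    have "?f \<in> ?S \<rightarrow>\<^sub>E obj Y" "?g \<in> ?S \<rightarrow>\<^sub>E obj Y"
      using s by (auto simp: compose_def farr_Fdiag fobj_Fdiag_Some the_inv_pcode[OF inf])
    then have "?f \<in> obj (ihom (discrete_vcat ?S) Y)" "?g \<in> obj (ihom (discrete_vcat ?S) Y)"
      by (simp_all add: obj_ihom_discrete_vcat[OF vY])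
    then have "r \<le> dst (Hom VCAT (discrete_vcat ?S) Y) ?f ?g \<longleftrightarrow>
        (\<forall>p\<in>?S. r \<le> dst Y (?f p) (?g p))"
      by (simp add: VCAT_of_simps dst_ihom le_INF_iff)
    also have "\<dots> \<longleftrightarrow> (\<forall>x'\<in>obj X. \<forall>x\<in>obj X. r \<le> dst X x' x \<longrightarrow> r \<le> dst Y (s x') (s x))"
      by (auto simp: compose_def farr_Fdiag fobj_Fdiag_Some the_inv_pcode[OF inf])
    finally show ?thesis .
  qed
  have "N_leg VCAT (DF X) Y s \<longleftrightarrow> s \<in> obj X \<rightarrow>\<^sub>E obj Y \<and>
      (\<forall>r. \<forall>x'\<in>obj X. \<forall>x\<in>obj X. r \<le> dst X x' x \<longrightarrow> r \<le> dst Y (s x') (s x))"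
    unfolding N_leg_def
    by (simp add: Comp_discrete obj_Hom_discrete[OF Y] * cong: conj_cong)
  also have "\<dots> \<longleftrightarrow> s \<in> obj (Hom VCAT X Y)"
    by (auto simp: VCAT_of_simps obj_ihom is_vfunctor_def PiE_def intro: order_trans)
  finally show ?thesis .
qed

text \<open>Legs into Y and V-functors X -> Y are the same functions, and composition with the cover
  leaves them unchanged. Distances agree as well, since both homs take the infimum over the objects
  of X.\<close>

lemma is_N_colim_DF:
  fixes X :: "('u, 'v::comm_quantale) vcat"
  assumes inf: "infinite (UNIV :: 'u set)" and X: "X \<in> Obj VCAT"
  shows "is_N_colim VCAT (DF X) X (cover X)"
proof -
  have cover: "Comp VCAT (discrete_vcat (obj X)) X Y h (cover X) = h"
    if "h \<in> obj (Hom VCAT X Y)" for h Y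
    using that by (auto simp: VCAT_of_simps obj_ihom compose_def fun_eq_iff extensional_def)
  have dst: "dst (Hom VCAT (discrete_vcat (obj X)) Y) h h' \<le> dst (Hom VCAT X Y) h h'"
    if Y: "Y \<in> Obj VCAT" and h: "h \<in> obj (Hom VCAT X Y)" "h' \<in> obj (Hom VCAT X Y)" for Y h h'
  proof -
    have "h \<in> obj (ihom (discrete_vcat (obj X)) Y)" "h' \<in> obj (ihom (discrete_vcat (obj X)) Y)"
      using h Y by (auto simp: VCAT_of_simps obj_ihom is_vfunctor_discrete_vcat vfunctor_obj)
    then show ?thesis
      using h by (simp add: VCAT_of_simps dst_ihom)
  qed
  have "N_leg VCAT (DF X) X (cover X)"
    using VCAT.Id_in[OF X] by (simp add: N_leg_DF[OF inf X X] VCAT_of_simps)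
  then show ?thesis
    by (simp add: is_N_colim_def X N_leg_DF[OF inf X] cover dst)
qed

text \<open>An equality of records rather than an isomorphism, because \<open>is_vcat\<close> fixes
  the distances outside the set of objects to bot.\<close>

lemma discrete_vcat_eq:
  "is_vcat X \<Longrightarrow> is_discrete X \<Longrightarrow> X = discrete_vcat (obj X)"
  by (cases X) (auto simp: is_vcat_def is_discrete_def discrete_vcat_def mk_vcat_def fun_eq_iff)

lemma is_discrete_discrete_vcat: "is_discrete (discrete_vcat A)"
  by (simp add: is_discrete_def dst_discrete_vcat)

text \<open>Distinct objects have distinct images under the inverse of u, so their distance is below
  bot. Self-distances lie between 1 and top, which coincide.\<close>

lemma iso_is_discrete:
  assumes integral: "(1::'v::comm_quantale) = top"
    and A: "A \<in> small_sets" and Y: "(Y :: ('u, 'v) vcat) \<in> Obj VCAT"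
    and u: "is_iso_in VCAT (discrete_vcat A) Y u"
  shows "is_discrete Y"
proof -
  obtain v where v: "v \<in> obj (ihom Y (discrete_vcat A))"
    and uv: "compose (obj Y) u v = (\<lambda>y\<in>obj Y. y)"
    using u by (auto simp: is_iso_in_def VCAT_of_simps)
  have inv: "u (v y) = y" if "y \<in> obj Y" for y
    using fun_cong[OF uv, of y] that by (simp add: compose_def)
  have "dst Y y' y = (if y' = y then 1 else bot)" if y: "y' \<in> obj Y" "y \<in> obj Y" for y' y
  proof (cases "y' = y")
    case True
    then show ?thesis
      using vcat_refl[of Y y] Y y integral by (simp add: VCAT_of_simps top_unique)
  next
    case False
    then have "v y' \<noteq> v y" using inv y by metis
    moreover have "dst Y y' y \<le> dst (discrete_vcat A) (v y') (v y)"
      using v y by (auto simp: obj_ihom vfunctor_dst)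
    ultimately show ?thesis using False by (simp add: dst_discrete_vcat bot_unique)
  qed
  then show ?thesis by (simp add: is_discrete_def)
qed

section \<open>The two implications\<close>

lemma weighted_diagram_Dfun:
  assumes "is_efunctor SETv VCAT H" and "X \<in> Obj VCAT"
  shows "weighted_diagram VCAT SETv (hom_into VCAT Dfun X) H"
  by (rule weighted_diagram_hom_into[OF is_ecat_VCAT_of assms(1) is_ecat_VCAT_of
        is_efunctor_Dfun assms(2)])

text \<open>The witness for T: the underlying sets and functions of G(D-).\<close>

definition restriction ::
    "(('u, 'v::comm_quantale) vcat, 'u \<Rightarrow> 'u, ('u, 'v) vcat, 'u \<Rightarrow> 'u) fctr \<Rightarrow>
     ('u set, 'u \<Rightarrow> 'u, 'u set, 'u \<Rightarrow> 'u) fctr" where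
  "restriction G = \<lparr>fobj = (\<lambda>A. obj (fobj G (discrete_vcat A))),
     farr = (\<lambda>A B. farr G (discrete_vcat A) (discrete_vcat B))\<rparr>"

lemma restriction_simps [simp]:
  "fobj (restriction G) A = obj (fobj G (discrete_vcat A))"
  "farr (restriction G) A B = farr G (discrete_vcat A) (discrete_vcat B)"
  by (simp_all add: restriction_def)

section \<open>Factorisation through the cover, and the Kan extension obtained from
  preservation\<close>

context
  fixes G :: "(('u, 'v::comm_quantale) vcat, 'u \<Rightarrow> 'u, ('u, 'v) vcat, 'u \<Rightarrow> 'u) fctr"
  assumes inf: "infinite (UNIV :: 'u set)"
    and integral: "(1::'v) = top"
    and G: "is_efunctor VCAT VCAT G"
begin

lemma G_obj: "X \<in> Obj VCAT \<Longrightarrow> fobj G X \<in> Obj VCAT"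
  by (rule efunctor_obj[OF G])

text \<open>Being an equality, this lets D T be rewritten to G D inside homs and composites, with no
  isomorphism to carry along.\<close>

lemma discrete_fobj:
  assumes "\<forall>X\<in>Obj VCAT. is_discrete X \<longrightarrow> is_discrete (fobj G X)" and A: "A \<in> small_sets"
  shows "discrete_vcat (obj (fobj G (discrete_vcat A))) = fobj G (discrete_vcat A)"
  using assms G_obj[OF discrete_in_VCAT[OF A]] discrete_vcat_eq[of "fobj G (discrete_vcat A)"]
  by (simp add: VCAT_of_simps is_discrete_discrete_vcat is_vcat_discrete_vcat)

lemma is_functor_restriction:
  assumes disc: "\<forall>X\<in>Obj VCAT. is_discrete X \<longrightarrow> is_discrete (fobj G X)"
  shows "is_functor SET SET (restriction G)"
proof -
  note D = discrete_fobj[OF disc]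
  have small: "obj (fobj G (discrete_vcat A)) \<in> small_sets" if "A \<in> small_sets" for A
    using G_obj[OF discrete_in_VCAT[OF that]] by (simp add: VCAT_of_simps)
  have arr: "farr G (discrete_vcat A) (discrete_vcat B) f \<in>
      obj (fobj G (discrete_vcat A)) \<rightarrow>\<^sub>E obj (fobj G (discrete_vcat B))"
    if "A \<in> small_sets" "B \<in> small_sets" "f \<in> A \<rightarrow>\<^sub>E B" for A B f
    using efunctor_arr[OF G discrete_in_VCAT discrete_in_VCAT, of A B f] that
      obj_Hom_discrete[OF G_obj[OF discrete_in_VCAT], of B "obj (fobj G (discrete_vcat A))"]
    by (simp add: D obj_Hom_discrete)
  have "farr G (discrete_vcat A) (discrete_vcat A) (\<lambda>x\<in>A. x) =
      (\<lambda>x\<in>obj (fobj G (discrete_vcat A)). x)" if "A \<in> small_sets" for A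
    using efunctor_Id[OF G discrete_in_VCAT[OF that]] by (simp add: VCAT_of_simps)
  moreover have "farr G (discrete_vcat A) (discrete_vcat C) (compose A g f) =
      compose (obj (fobj G (discrete_vcat A))) (farr G (discrete_vcat B) (discrete_vcat C) g)
        (farr G (discrete_vcat A) (discrete_vcat B) f)"
    if "A \<in> small_sets" "B \<in> small_sets" "C \<in> small_sets" "f \<in> A \<rightarrow>\<^sub>E B" "g \<in> B \<rightarrow>\<^sub>E C" for A B C f g
    using efunctor_Comp[OF G, of "discrete_vcat A" "discrete_vcat B" "discrete_vcat C" f g] that
    by (simp add: obj_Hom_discrete Comp_discrete) (simp add: VCAT_of_simps)
  ultimately show ?thesis
    by (simp add: is_functor_def small arr)
qed

lemma preserves_iff:
  assumes X: "X \<in> Obj VCAT"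
  shows "preserves_wcolim Nv VCAT VCAT Nwt (DF X) G \<longleftrightarrow>
    is_N_colim VCAT (functor_comp G (DF X)) (fobj G X)
      (farr G (discrete_vcat (obj X)) X (cover X))"
  using preserves_wcolim_Nwt_iff[OF is_ecat_VCAT_of is_ecat_VCAT_of is_efunctor_DF[OF inf X] G
      is_N_colim_DF[OF inf X]] by simp

lemma small_obj: "X \<in> Obj VCAT \<Longrightarrow> obj X \<in> small_sets"
  by (simp add: VCAT_of_simps)

text \<open>G is applied to the factorisation of f through the cover. On the right-hand side f is
  read as an arrow into D(obj X), hence the different arguments of \<open>farr G\<close>.\<close>

lemma farr_lift_cover:
  assumes X: "X \<in> Obj VCAT" and A: "A \<in> small_sets" and f: "f \<in> obj (Hom VCAT (discrete_vcat A) X)"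
  shows "farr G (discrete_vcat A) X f =
    Comp VCAT (fobj G (discrete_vcat A)) (fobj G (discrete_vcat (obj X))) (fobj G X)
      (farr G (discrete_vcat (obj X)) X (cover X))
      (farr G (discrete_vcat A) (discrete_vcat (obj X)) f)"
  using efunctor_Comp[OF G discrete_in_VCAT[OF A] discrete_in_VCAT[OF small_obj[OF X]] X
      lift_cover(1)[OF X A f] cover_in[OF X]] lift_cover(2)[OF X A f]
  by simp

text \<open>The two projections X_r -> X, read as V-functors out of D(X_r), are at distance at least
  r because the cover is a leg. The component of \<sigma> at X_r is a V-functor and keeps this
  bound, and naturality writes its two values as composites of the component at the cover.\<close>

lemma N_leg_at_cover:
  fixes X :: "('u, 'v) vcat"
  assumes H: "is_efunctor SETv VCAT H" and X: "X \<in> Obj VCAT" and Y: "Y \<in> Obj VCAT"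
    and \<sigma>: "cylinder SETv VCAT (hom_into VCAT Dfun X) H Y \<sigma>"
  shows "N_leg VCAT (functor_comp H (Fdiag X)) Y (\<sigma> (obj X) (cover X))"
proof -
  have leg: "N_leg VCAT (DF X) X (cover X)"
    using is_N_colim_DF[OF inf X] by (simp add: is_N_colim_def)
  have S: "fobj (Fdiag X) a \<in> small_sets" for a
    using is_functor_Fdiag[OF inf X] by (simp add: is_functor_def)
  have arr: "farr (Fdiag X) (Some r) None k \<in> fobj (Fdiag X) (Some r) \<rightarrow>\<^sub>E obj X"
    if "k \<in> {Del0, Del1}" for r k
    using is_functor_Fdiag[OF inf X] that unfolding is_functor_def
    by (metis Fdiag_None Ncat_simps(1,2) SET_simps(2) UNIV_I option.distinct(1))
  have nat: "Comp VCAT (fobj H (fobj (Fdiag X) (Some r))) (fobj H (obj X)) Y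
        (\<sigma> (obj X) (cover X)) (farr H (fobj (Fdiag X) (Some r)) (obj X) (farr (Fdiag X) (Some r) None k))
      = \<sigma> (fobj (Fdiag X) (Some r)) (Comp VCAT (discrete_vcat (fobj (Fdiag X) (Some r)))
          (discrete_vcat (obj X)) X (cover X) (farr (Fdiag X) (Some r) None k))"
    if "k \<in> {Del0, Del1}" for r k
    using cylinder_natural[OF \<sigma>, of "obj X" "fobj (Fdiag X) (Some r)"
        "farr (Fdiag X) (Some r) None k" "cover X"] arr[OF that] S cover_in[OF X] small_obj[OF X]
    by simp
  have "r \<le> dst (Hom VCAT (fobj H (fobj (Fdiag X) (Some r))) Y)
      (\<sigma> (fobj (Fdiag X) (Some r)) (Comp VCAT (discrete_vcat (fobj (Fdiag X) (Some r)))
          (discrete_vcat (obj X)) X (cover X) (farr (Fdiag X) (Some r) None Del0)))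
      (\<sigma> (fobj (Fdiag X) (Some r)) (Comp VCAT (discrete_vcat (fobj (Fdiag X) (Some r)))
          (discrete_vcat (obj X)) X (cover X) (farr (Fdiag X) (Some r) None Del1)))" for r
  proof -
    have c: "Comp VCAT (discrete_vcat (fobj (Fdiag X) (Some r))) (discrete_vcat (obj X)) X
        (cover X) (farr (Fdiag X) (Some r) None k) \<in>
        obj (Hom VCAT (discrete_vcat (fobj (Fdiag X) (Some r))) X)"
      if "k \<in> {Del0, Del1}" for k
      using that arr[OF that, of r] S small_obj[OF X] X
      by (intro VCAT.Comp_in cover_in) (simp_all add: obj_Hom_discrete)
    show ?thesis
      using leg cylinder_dst[OF \<sigma>, of "fobj (Fdiag X) (Some r)"] c[of Del0] c[of Del1] S
      by (auto simp: N_leg_def intro: order_trans)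
  qed
  moreover have "\<sigma> (obj X) (cover X) \<in> obj (Hom VCAT (fobj H (obj X)) Y)"
    using cylinder_in[OF \<sigma>, of "obj X" "cover X"] small_obj[OF X] cover_in[OF X] by simp
  ultimately show ?thesis
    by (simp add: N_leg_def nat)
qed

text \<open>The universal cylinder is f |-> G f. A competing cylinder gives a leg at the cover,
  hence an arrow h by the colimit property of G X; as every f factors through the cover, h
  reproduces the whole cylinder.\<close>

lemma lan_of_preserves:
  assumes pres: "\<forall>X\<in>Obj VCAT. preserves_wcolim Nv VCAT VCAT Nwt (DF X) G"
    and disc: "\<forall>X\<in>Obj VCAT. is_discrete X \<longrightarrow> is_discrete (fobj G X)"
  shows "is_vcatification (restriction G) G"
proof -
  let ?H = "functor_comp Dfun (restriction G)"
  have H: "is_efunctor SETv VCAT ?H"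
    by (rule is_efunctor_comp[OF is_efunctor_free_ecat[OF is_functor_restriction[OF disc]]
        is_efunctor_Dfun])
  note D = discrete_fobj[OF disc]
  define lam where "lam X = (\<lambda>A\<in>small_sets.
    \<lambda>f\<in>obj (Hom VCAT (discrete_vcat A) X). farr G (discrete_vcat A) X f)"
    for X :: "('u, 'v) vcat"
  have lam: "lam X A f = farr G (discrete_vcat A) X f"
    if "A \<in> small_sets" "f \<in> obj (Hom VCAT (discrete_vcat A) X)" for X A f
    using that by (simp add: lam_def)
  have G_arr: "farr G (discrete_vcat A) X f \<in> obj (Hom VCAT (fobj G (discrete_vcat A)) (fobj G X))"
    if "X \<in> Obj VCAT" "A \<in> small_sets" "f \<in> obj (Hom VCAT (discrete_vcat A) X)" for X A f
    using efunctor_arr[OF G] that by simp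
  have "is_wcolim SETv VCAT (hom_into VCAT Dfun X) ?H (fobj G X) (lam X)"
    if X: "X \<in> Obj VCAT" for X
  proof -
    interpret weighted_diagram VCAT SETv "hom_into VCAT Dfun X" ?H
      by (rule weighted_diagram_Dfun[OF H X])
    note S = small_obj[OF X]
    let ?q = "farr G (discrete_vcat (obj X)) X (cover X)"
    have N: "is_N_colim VCAT (functor_comp G (DF X)) (fobj G X) ?q"
      using pres preserves_iff[OF X] X by simp
    have at_cover: "lam X (obj X) (cover X) = ?q"
      by (rule lam[OF S cover_in[OF X]])
    show ?thesis
    proof (rule wcolimI[OF G_obj[OF X]])
      show "cylinder SETv VCAT (hom_into VCAT Dfun X) ?H (fobj G X) (lam X)"
      proof (rule cylinderI)
        fix A f f' assume "A \<in> Obj SETv" "f \<in> obj (fobj (hom_into VCAT Dfun X) A)"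
          "f' \<in> obj (fobj (hom_into VCAT Dfun X) A)"
        then show "dst (fobj (hom_into VCAT Dfun X) A) f f' \<le>
            dst (Hom VCAT (fobj ?H A) (fobj G X)) (lam X A f) (lam X A f')"
          using vfunctor_dst[OF efunctor_vfunctor[OF G discrete_in_VCAT X]] by (simp add: lam D)
      next
        fix A B k f assume *: "A \<in> Obj SETv" "B \<in> Obj SETv" "k \<in> obj (Hom SETv B A)"
          "f \<in> obj (fobj (hom_into VCAT Dfun X) A)"
        then have k: "k \<in> obj (Hom VCAT (discrete_vcat B) (discrete_vcat A))"
          by (simp add: obj_Hom_discrete)
        have "Comp VCAT (discrete_vcat B) (discrete_vcat A) X f k \<in>
            obj (Hom VCAT (discrete_vcat B) X)"
          using * k X by (intro VCAT.Comp_in) simp_all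
        then show "Comp VCAT (fobj ?H B) (fobj ?H A) (fobj G X) (lam X A f) (farr ?H B A k) =
            lam X B (farr (hom_into VCAT Dfun X) A B k f)"
          using * k efunctor_Comp[OF G discrete_in_VCAT discrete_in_VCAT X k, of f]
          by (simp add: lam D)
      qed (simp_all add: G_arr D X lam, simp_all add: lam_def)
    next
      fix Y \<sigma> assume Y: "Y \<in> Obj VCAT"
        and \<sigma>: "cylinder SETv VCAT (hom_into VCAT Dfun X) ?H Y \<sigma>"
      \<comment> \<open>The identification of D T with G D holds on small sets, so smallness of each
        X_r is what turns a leg for D T into a leg for G D.\<close>
      have "fobj (Fdiag X) a \<in> small_sets" for a
        using is_functor_Fdiag[OF inf X] by (simp add: is_functor_def)
      then have "N_leg VCAT (functor_comp G (DF X)) Y (\<sigma> (obj X) (cover X))"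
        using N_leg_at_cover[OF H X Y \<sigma>] S by (simp add: N_leg_def D)
      then obtain h where h: "h \<in> obj (Hom VCAT (fobj G X) Y)"
        and hq: "Comp VCAT (fobj G (discrete_vcat (obj X))) (fobj G X) Y h ?q = \<sigma> (obj X) (cover X)"
        using N_colim_ex[OF N Y] by auto
      have "Comp VCAT (fobj G (discrete_vcat A)) (fobj G X) Y h (lam X A f) = \<sigma> A f"
        if A: "A \<in> small_sets" and f: "f \<in> obj (Hom VCAT (discrete_vcat A) X)" for A f
      proof -
        note f' = lift_cover[OF X A f]
        have "Comp VCAT (fobj G (discrete_vcat A)) (fobj G X) Y h (lam X A f) =
            Comp VCAT (fobj G (discrete_vcat A)) (fobj G (discrete_vcat (obj X))) Y
              (\<sigma> (obj X) (cover X)) (farr G (discrete_vcat A) (discrete_vcat (obj X)) f)"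
          unfolding hq[symmetric] lam[OF A f] farr_lift_cover[OF X A f]
          using A S X Y f'(1)
          by (intro VCAT.Comp_assoc[symmetric] h G_arr cover_in G_obj discrete_in_VCAT)
        also have "\<dots> = \<sigma> A (Comp VCAT (discrete_vcat A) (discrete_vcat (obj X)) X (cover X) f)"
          using cylinder_natural[OF \<sigma>, of "obj X" A f "cover X"] A S f'(1) cover_in[OF X]
          by (simp add: D obj_Hom_discrete)
        finally show ?thesis using f'(2) by simp
      qed
      then show "\<exists>h\<in>obj (Hom VCAT (fobj G X) Y). \<forall>A\<in>Obj SETv.
          \<forall>f\<in>obj (fobj (hom_into VCAT Dfun X) A).
            Comp VCAT (fobj ?H A) (fobj G X) Y h (lam X A f) = \<sigma> A f"
        using h by (intro bexI[of _ h]) (simp_all add: D)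
    next
      fix Y h h' assume Y: "Y \<in> Obj VCAT" "h \<in> obj (Hom VCAT (fobj G X) Y)"
        "h' \<in> obj (Hom VCAT (fobj G X) Y)"
        and *: "\<And>A f. A \<in> Obj SETv \<Longrightarrow> f \<in> obj (fobj (hom_into VCAT Dfun X) A) \<Longrightarrow>
          Comp VCAT (fobj ?H A) (fobj G X) Y h (lam X A f) =
          Comp VCAT (fobj ?H A) (fobj G X) Y h' (lam X A f)"
      \<comment> \<open>The cover is itself one of the arrows f, so the hypothesis at the cover
        already contains the test on the leg q.\<close>
      show "h = h'"
        using N Y *[of "obj X" "cover X"] S cover_in[OF X]
        by (simp add: is_N_colim_def at_cover D)
    next
      fix Y h h' r assume Y: "Y \<in> Obj VCAT" "h \<in> obj (Hom VCAT (fobj G X) Y)"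
        "h' \<in> obj (Hom VCAT (fobj G X) Y)"
        and *: "\<And>A f. A \<in> Obj SETv \<Longrightarrow> f \<in> obj (fobj (hom_into VCAT Dfun X) A) \<Longrightarrow>
          r \<le> dst (Hom VCAT (fobj ?H A) Y) (Comp VCAT (fobj ?H A) (fobj G X) Y h (lam X A f))
            (Comp VCAT (fobj ?H A) (fobj G X) Y h' (lam X A f))"
      show "r \<le> dst (Hom VCAT (fobj G X) Y) h h'"
        using N Y *[of "obj X" "cover X"] S cover_in[OF X]
        by (auto simp: is_N_colim_def at_cover D intro: order_trans)
    qed
  qed
  moreover have "Comp VCAT (fobj ?H A) (fobj G X) (fobj G X') (farr G X X' g) (lam X A f) =
      lam X' A (Comp VCAT (fobj Dfun A) X X' g f)"
    if *: "X \<in> Obj VCAT" "X' \<in> Obj VCAT" "g \<in> obj (Hom VCAT X X')" "A \<in> Obj SETv"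
      "f \<in> obj (Hom VCAT (fobj Dfun A) X)" for X X' g A f
  proof -
    have "Comp VCAT (discrete_vcat A) X X' g f \<in> obj (Hom VCAT (discrete_vcat A) X')"
      using * by (intro VCAT.Comp_in) simp_all
    then show ?thesis
      using * efunctor_Comp[OF G discrete_in_VCAT *(1,2) _ *(3), of A f] by (simp add: lam D)
  qed
  ultimately show ?thesis
    unfolding is_vcatification_def is_lan_def using G
    by (intro conjI exI[of _ lam] ballI) blast+
qed

text \<open>Allows G itself to serve as the Kan extension to which G has to be isomorphic.\<close>

lemma efunctors_iso_refl: "efunctors_iso VCAT VCAT G G"
  unfolding efunctors_iso_def
proof (intro exI[of _ "\<lambda>X. Id VCAT (fobj G X)"] conjI ballI)
  fix X Y :: "('u, 'v) vcat" and f assume "X \<in> Obj VCAT" "Y \<in> Obj VCAT" "f \<in> obj (Hom VCAT X Y)"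
  then show "Comp VCAT (fobj G X) (fobj G Y) (fobj G Y) (Id VCAT (fobj G Y)) (farr G X Y f) =
      Comp VCAT (fobj G X) (fobj G X) (fobj G Y) (farr G X Y f) (Id VCAT (fobj G X))"
    by (simp add: VCAT.Comp_Id VCAT.Id_Comp G_obj efunctor_arr[OF G])
next
  fix X :: "('u, 'v) vcat" assume "X \<in> Obj VCAT"
  then show "is_iso_in VCAT (fobj G X) (fobj G X) (Id VCAT (fobj G X))"
    unfolding is_iso_in_def using VCAT.Id_in[OF G_obj] VCAT.Comp_Id[OF G_obj G_obj VCAT.Id_in[OF G_obj]]
    by blast
qed

text \<open>
  Yoneda: since the quantale is integral, \<open>V-cat(D-, DA)\<close> is the discrete enrichment of \<open>Set(-, A)\<close>.
\<close>

lemma yoneda_wcolim: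
  assumes H: "is_efunctor SETv (VCAT :: (('u, 'v) vcat, _, _) ecat) H" and A: "A \<in> small_sets"
  shows "is_wcolim SETv (VCAT :: (('u, 'v) vcat, _, _) ecat) (hom_into VCAT Dfun (discrete_vcat A)) H
    (fobj H A) (\<lambda>B\<in>small_sets. \<lambda>f\<in>B \<rightarrow>\<^sub>E A. farr H B A f)" (is "is_wcolim _ _ ?W _ _ ?lam")
proof -
  interpret weighted_diagram "VCAT :: (('u, 'v) vcat, _, _) ecat" SETv ?W H
    by (rule weighted_diagram_Dfun[OF H discrete_in_VCAT[OF A]])
  have HA: "fobj H A \<in> Obj VCAT"
    using F_obj A by simp
  have H_arr: "farr H B C f \<in> obj (Hom VCAT (fobj H B) (fobj H C))"
    if "B \<in> small_sets" "C \<in> small_sets" "f \<in> B \<rightarrow>\<^sub>E C" for B C f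
    using F_arr that by simp
  have W [simp]: "obj (fobj ?W B) = B \<rightarrow>\<^sub>E A" for B
    by (simp add: obj_Hom_discrete A)
  have id: "(\<lambda>x\<in>A. x) \<in> A \<rightarrow>\<^sub>E A"
    by simp
  have H_id: "farr H A A (\<lambda>x\<in>A. x) = Id VCAT (fobj H A)"
    using efunctor_Id[OF H, of A] A by simp
  \<comment> \<open>H preserves identities, so composing h with the cylinder at the identity of A
    returns h; uniqueness and distances are both tested there.\<close>
  have at_id: "Comp VCAT (fobj H A) (fobj H A) Y h (?lam A (\<lambda>x\<in>A. x)) = h"
    if "Y \<in> Obj VCAT" "h \<in> obj (Hom VCAT (fobj H A) Y)" for Y h
    using that A id by (simp add: H_id VCAT.Comp_Id HA)
  show ?thesis
  proof (rule wcolimI[OF HA])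
    show "cylinder SETv VCAT ?W H (fobj H A) ?lam"
    proof (rule cylinderI)
      fix B f g assume *: "B \<in> Obj SETv" "f \<in> obj (fobj ?W B)" "g \<in> obj (fobj ?W B)"
      show "dst (fobj ?W B) f g \<le> dst (Hom VCAT (fobj H B) (fobj H A)) (?lam B f) (?lam B g)"
      \<comment> \<open>For f = g the distance is an infimum of units, which is top when B is empty;
        integrality bounds it by 1 in every case.\<close>
      proof (cases "f = g")
        case True
        have "1 \<le> dst (Hom VCAT (fobj H B) (fobj H A)) (farr H B A f) (farr H B A f)"
          using * A H_arr F_obj
          by (intro vcat_refl VCAT.is_vcat_Hom HA) (simp_all add: obj_Hom_discrete)
        moreover have "dst (fobj ?W B) f g \<le> 1"
          unfolding integral by (rule top_greatest)
        ultimately have "dst (fobj ?W B) f g \<le>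
            dst (Hom VCAT (fobj H B) (fobj H A)) (farr H B A f) (farr H B A f)"
          by (rule order_trans[rotated])
        then show ?thesis
          using * True by (simp add: obj_Hom_discrete A)
      next
        case False
        \<comment> \<open>At a point where f and g differ, the discrete codomain gives distance bot,
          which bounds the infimum.\<close>
        then obtain x where x: "x \<in> B" "f x \<noteq> g x"
          using *(2,3) PiE_ext[of f B "\<lambda>_. A" g] unfolding W by blast
        have "dst (fobj ?W B) f g \<le> dst (discrete_vcat A) (f x) (g x)"
          using dst_Hom_discrete_le[of f B "discrete_vcat A" g] * x by simp
        then show ?thesis
          using x by (simp add: dst_discrete_vcat bot_unique)
      qed
    next
      fix B C k f assume *: "B \<in> Obj SETv" "C \<in> Obj SETv" "k \<in> obj (Hom SETv C B)"
        "f \<in> obj (fobj ?W B)"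
      then have f: "f \<in> B \<rightarrow>\<^sub>E A" and k: "k \<in> C \<rightarrow>\<^sub>E B"
        using W by simp_all
      then have "compose C f k \<in> C \<rightarrow>\<^sub>E A"
        by (auto simp: compose_def)
      then show "Comp VCAT (fobj H C) (fobj H B) (fobj H A) (?lam B f) (farr H C B k) =
          ?lam C (farr ?W B C k f)"
        using * f k efunctor_Comp[OF H, of C B A k f] A
        by (simp add: obj_Hom_discrete Comp_discrete)
    qed (simp_all add: H_arr A W del: hom_into_simps)
  next
    fix Y \<sigma> assume Y: "Y \<in> Obj VCAT" and \<sigma>: "cylinder SETv VCAT ?W H Y \<sigma>"
    \<comment> \<open>The arrow representing \<sigma> is its value at the identity of A; naturality
      along f recovers the other components.\<close>
    have "Comp VCAT (fobj H B) (fobj H A) Y (\<sigma> A (\<lambda>x\<in>A. x)) (?lam B f) = \<sigma> B f"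
      if "B \<in> small_sets" "f \<in> B \<rightarrow>\<^sub>E A" for B f
    proof -
      have "compose B (\<lambda>x\<in>A. x) f = f"
        using that by (auto simp: compose_def fun_eq_iff)
      then show ?thesis
        using cylinder_natural[OF \<sigma>, of A B f "\<lambda>x\<in>A. x"] that A id
        by (simp add: obj_Hom_discrete Comp_discrete)
    qed
    moreover have "\<sigma> A (\<lambda>x\<in>A. x) \<in> obj (Hom VCAT (fobj H A) Y)"
      using cylinder_in[OF \<sigma>, of A "\<lambda>x\<in>A. x"] A id W by simp
    ultimately show "\<exists>h\<in>obj (Hom VCAT (fobj H A) Y). \<forall>B\<in>Obj SETv. \<forall>f\<in>obj (fobj ?W B).
        Comp VCAT (fobj H B) (fobj H A) Y h (?lam B f) = \<sigma> B f"
      by (intro bexI[of _ "\<sigma> A (\<lambda>x\<in>A. x)"] ballI) (simp_all only: W free_ecat_simps SET_simps)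
  next
    fix Y h h' assume *: "Y \<in> Obj VCAT" "h \<in> obj (Hom VCAT (fobj H A) Y)"
      "h' \<in> obj (Hom VCAT (fobj H A) Y)"
      "\<And>B f. B \<in> Obj SETv \<Longrightarrow> f \<in> obj (fobj ?W B) \<Longrightarrow>
        Comp VCAT (fobj H B) (fobj H A) Y h (?lam B f) = Comp VCAT (fobj H B) (fobj H A) Y h' (?lam B f)"
    show "h = h'"
      using *(4)[of A "\<lambda>x\<in>A. x"] W id A unfolding at_id[OF *(1,2)] at_id[OF *(1,3)] by simp
  next
    fix Y h h' r assume *: "Y \<in> Obj VCAT" "h \<in> obj (Hom VCAT (fobj H A) Y)"
      "h' \<in> obj (Hom VCAT (fobj H A) Y)"
      "\<And>B f. B \<in> Obj SETv \<Longrightarrow> f \<in> obj (fobj ?W B) \<Longrightarrow> r \<le> dst (Hom VCAT (fobj H B) Y)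
        (Comp VCAT (fobj H B) (fobj H A) Y h (?lam B f))
        (Comp VCAT (fobj H B) (fobj H A) Y h' (?lam B f))"
    show "r \<le> dst (Hom VCAT (fobj H A) Y) h h'"
      using *(4)[of A "\<lambda>x\<in>A. x"] W id A unfolding at_id[OF *(1,2)] at_id[OF *(1,3)] by simp
  qed
qed

section \<open>From the Kan extension to discreteness and preservation\<close>

context
  fixes T :: "('u set, 'u \<Rightarrow> 'u, 'u set, 'u \<Rightarrow> 'u) fctr"
  assumes T: "is_functor SET SET T" and lan: "is_vcatification T G"
begin

abbreviation H :: "('u set, 'u \<Rightarrow> 'u, ('u, 'v) vcat, 'u \<Rightarrow> 'u) fctr" where
  "H \<equiv> functor_comp Dfun T"

lemma is_efunctor_H: "is_efunctor SETv VCAT H"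
  by (rule is_efunctor_comp[OF is_efunctor_free_ecat[OF T] is_efunctor_Dfun])

text \<open>
  By naturality in \<open>X\<close>, the cylinders of the Kan extension are determined by the components
  \<open>b A : D (T A) \<rightarrow> G (D A)\<close> at the identities, which are invertible by the Yoneda lemma.
\<close>

lemma lan_cylinder:
  obtains lam :: "('u, 'v) vcat \<Rightarrow> 'u set \<Rightarrow> ('u \<Rightarrow> 'u) \<Rightarrow> 'u \<Rightarrow> 'u"
    and b :: "'u set \<Rightarrow> 'u \<Rightarrow> 'u"
  where "\<And>X. X \<in> Obj VCAT \<Longrightarrow> is_wcolim SETv VCAT (hom_into VCAT Dfun X) H (fobj G X) (lam X)"
    and "\<And>A. A \<in> small_sets \<Longrightarrow> is_iso_in VCAT (fobj H A) (fobj G (discrete_vcat A)) (b A)"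
    and "\<And>X A f. X \<in> Obj VCAT \<Longrightarrow> A \<in> small_sets \<Longrightarrow> f \<in> obj (Hom VCAT (discrete_vcat A) X) \<Longrightarrow>
      lam X A f = Comp VCAT (fobj H A) (fobj G (discrete_vcat A)) (fobj G X)
        (farr G (discrete_vcat A) X f) (b A)"
    and "\<And>A B k. A \<in> small_sets \<Longrightarrow> B \<in> small_sets \<Longrightarrow> k \<in> B \<rightarrow>\<^sub>E A \<Longrightarrow>
      Comp VCAT (fobj H B) (fobj H A) (fobj G (discrete_vcat A)) (b A) (farr H B A k) =
      Comp VCAT (fobj H B) (fobj G (discrete_vcat B)) (fobj G (discrete_vcat A))
        (farr G (discrete_vcat B) (discrete_vcat A) k) (b B)"
proof -
  obtain lam :: "('u, 'v) vcat \<Rightarrow> 'u set \<Rightarrow> ('u \<Rightarrow> 'u) \<Rightarrow> 'u \<Rightarrow> 'u"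
    where lam: "\<And>X. X \<in> Obj VCAT \<Longrightarrow>
        is_wcolim SETv VCAT (hom_into VCAT Dfun X) H (fobj G X) (lam X)"
    and nat: "\<And>X X' g A f. \<lbrakk>X \<in> Obj VCAT; X' \<in> Obj VCAT; g \<in> obj (Hom VCAT X X');
      A \<in> small_sets; f \<in> obj (Hom VCAT (discrete_vcat A) X)\<rbrakk> \<Longrightarrow>
        Comp VCAT (fobj H A) (fobj G X) (fobj G X') (farr G X X' g) (lam X A f) =
        lam X' A (Comp VCAT (discrete_vcat A) X X' g f)"
    using lan unfolding is_vcatification_def is_lan_def free_ecat_simps(1) SET_simps(1) Dfun_simps(1)
    by blast
  define b where "b A = lam (discrete_vcat A) A (\<lambda>x\<in>A. x)" for A
  have id: "(\<lambda>x\<in>A. x) \<in> obj (Hom VCAT (discrete_vcat A) (discrete_vcat A))"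
    if "A \<in> small_sets" for A
    using that by (simp add: obj_Hom_discrete)
  have lam_b: "lam X A f = Comp VCAT (fobj H A) (fobj G (discrete_vcat A)) (fobj G X)
        (farr G (discrete_vcat A) X f) (b A)"
    if *: "X \<in> Obj VCAT" "A \<in> small_sets" "f \<in> obj (Hom VCAT (discrete_vcat A) X)" for X A f
  proof -
    have "Comp VCAT (discrete_vcat A) (discrete_vcat A) X f (\<lambda>x\<in>A. x) = f"
      using VCAT.Comp_Id[OF discrete_in_VCAT[OF *(2)] *(1,3)] by (simp add: Id_discrete)
    \<comment> \<open>Naturality of the cylinders in X, taken along f and evaluated at the identity
      of A.\<close>
    then show ?thesis
      using nat[OF discrete_in_VCAT[OF *(2)] *(1,3,2) id[OF *(2)]] by (simp add: b_def)
  qed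
  show thesis
  proof (rule that[OF lam _ lam_b])
    fix A :: "'u set" assume A: "A \<in> small_sets"
    interpret weighted_diagram "VCAT :: (('u, 'v) vcat, _, _) ecat" SETv
      "hom_into VCAT Dfun (discrete_vcat A)" H
      by (rule weighted_diagram_Dfun[OF is_efunctor_H discrete_in_VCAT[OF A]])
    obtain u where u: "is_iso_in VCAT (fobj H A) (fobj G (discrete_vcat A)) u"
      and u_lam: "\<And>B f. B \<in> small_sets \<Longrightarrow> f \<in> B \<rightarrow>\<^sub>E A \<Longrightarrow>
        Comp VCAT (fobj H B) (fobj H A) (fobj G (discrete_vcat A)) u (farr H B A f) =
        lam (discrete_vcat A) B f"
    proof (rule wcolim_unique[OF yoneda_wcolim[OF is_efunctor_H A] lam[OF discrete_in_VCAT[OF A]]])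
      fix u assume u: "is_iso_in VCAT (fobj H A) (fobj G (discrete_vcat A)) u"
        and *: "\<And>B w. B \<in> Obj SETv \<Longrightarrow> w \<in> obj (fobj (hom_into VCAT Dfun (discrete_vcat A)) B) \<Longrightarrow>
          Comp VCAT (fobj H B) (fobj H A) (fobj G (discrete_vcat A)) u
            ((\<lambda>B\<in>small_sets. \<lambda>f\<in>B \<rightarrow>\<^sub>E A. farr H B A f) B w) = lam (discrete_vcat A) B w"
      show thesis
        using *  by (intro that[OF u]) (force simp: obj_Hom_discrete A)
    qed
    have "u \<in> obj (Hom VCAT (fobj H A) (fobj G (discrete_vcat A)))"
      using u by (simp add: is_iso_in_def)
    \<comment> \<open>The comparison with the Yoneda colimit is evaluated at the identity of A,
      which H preserves.\<close>
    then have "u = b A"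
      using u_lam[of A "\<lambda>x\<in>A. x"] efunctor_Id[OF is_efunctor_H, of A]
        VCAT.Comp_Id[OF efunctor_obj[OF is_efunctor_H] G_obj[OF discrete_in_VCAT[OF A]], of A u] A
      by (simp add: b_def)
    then show "is_iso_in VCAT (fobj H A) (fobj G (discrete_vcat A)) (b A)"
      using u by simp
    \<comment> \<open>The cylinder at DA on k is computed twice: through the comparison u, now known
      to be b A, and through \<open>lam_b\<close>.\<close>
    fix B :: "'u set" and k assume B: "B \<in> small_sets" and k: "k \<in> B \<rightarrow>\<^sub>E A"
    then show "Comp VCAT (fobj H B) (fobj H A) (fobj G (discrete_vcat A)) (b A) (farr H B A k) =
      Comp VCAT (fobj H B) (fobj G (discrete_vcat B)) (fobj G (discrete_vcat A))
        (farr G (discrete_vcat B) (discrete_vcat A) k) (b B)"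
      using u_lam[OF B k] lam_b[OF discrete_in_VCAT[OF A] B, of k] \<open>u = b A\<close> A
      by (simp add: obj_Hom_discrete)
  qed
qed

text \<open>A discrete X equals D(obj X), and b identifies G D(obj X) with the discrete D(T (obj
  X)); discreteness passes along this isomorphism.\<close>

lemma vcatification_is_discrete:
  assumes X: "X \<in> Obj VCAT" and disc: "is_discrete X"
  shows "is_discrete (fobj G X)"
proof -
  have eq: "X = discrete_vcat (obj X)"
    using discrete_vcat_eq[OF _ disc] X by (simp add: VCAT_of_simps)
  obtain b where "is_iso_in VCAT (fobj H (obj X)) (fobj G (discrete_vcat (obj X))) b"
  proof (rule lan_cylinder)
    fix b assume "\<And>A. A \<in> small_sets \<Longrightarrow> is_iso_in VCAT (fobj H A) (fobj G (discrete_vcat A)) (b A)"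
    then show thesis
      using that small_obj[OF X] by blast
  qed
  moreover have "fobj T (obj X) \<in> small_sets"
    using T small_obj[OF X] by (simp add: is_functor_def)
  ultimately show ?thesis
    using iso_is_discrete[OF integral _ G_obj[OF X], of "fobj T (obj X)" b] eq by simp
qed

text \<open>A leg s out of G D(obj X) yields the component \<open>s \<circ> G f \<circ> b A\<close>
  at f, called \<open>tr\<close> below. Invertibility of b at obj X makes s recoverable from the
  component at the cover. The leg condition provides V-functoriality in f, because two functors at
  distance r factor jointly through X_r.\<close>

lemma vcatification_N_colim:
  assumes X: "X \<in> Obj VCAT"
  shows "is_N_colim VCAT (functor_comp G (DF X)) (fobj G X)
    (farr G (discrete_vcat (obj X)) X (cover X))"
proof (rule lan_cylinder)
  fix lam :: "('u, 'v) vcat \<Rightarrow> 'u set \<Rightarrow> ('u \<Rightarrow> 'u) \<Rightarrow> 'u \<Rightarrow> 'u"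
    and b :: "'u set \<Rightarrow> 'u \<Rightarrow> 'u"
  assume all_lam: "\<And>X. X \<in> Obj VCAT \<Longrightarrow>
        is_wcolim SETv VCAT (hom_into VCAT Dfun X) H (fobj G X) (lam X)"
    and b_iso: "\<And>A. A \<in> small_sets \<Longrightarrow> is_iso_in VCAT (fobj H A) (fobj G (discrete_vcat A)) (b A)"
    and all_lam_b: "\<And>X A f. X \<in> Obj VCAT \<Longrightarrow> A \<in> small_sets \<Longrightarrow>
      f \<in> obj (Hom VCAT (discrete_vcat A) X) \<Longrightarrow>
      lam X A f = Comp VCAT (fobj H A) (fobj G (discrete_vcat A)) (fobj G X)
        (farr G (discrete_vcat A) X f) (b A)"
    and b_nat: "\<And>A B k. A \<in> small_sets \<Longrightarrow> B \<in> small_sets \<Longrightarrow> k \<in> B \<rightarrow>\<^sub>E A \<Longrightarrow>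
      Comp VCAT (fobj H B) (fobj H A) (fobj G (discrete_vcat A)) (b A) (farr H B A k) =
      Comp VCAT (fobj H B) (fobj G (discrete_vcat B)) (fobj G (discrete_vcat A))
        (farr G (discrete_vcat B) (discrete_vcat A) k) (b B)"
  note lam = all_lam[OF X] and lam_b = all_lam_b[OF X]
  interpret weighted_diagram "VCAT :: (('u, 'v) vcat, _, _) ecat" SETv "hom_into VCAT Dfun X" H
    by (rule weighted_diagram_Dfun[OF is_efunctor_H X])
  let ?D = "\<lambda>A. discrete_vcat A :: ('u, 'v) vcat"
  let ?A = "obj X" and ?q = "farr G (discrete_vcat (obj X)) X (cover X)"
  note S = small_obj[OF X]
  have b: "b A \<in> obj (Hom VCAT (fobj H A) (fobj G (?D A)))" if "A \<in> small_sets" for A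
    using b_iso[OF that] by (simp add: is_iso_in_def)
  have O: "fobj H A \<in> Obj VCAT" "fobj G (?D A) \<in> Obj VCAT" if "A \<in> small_sets" for A
    using that F_obj by (simp_all add: G_obj)
  have lift: "farr G (?D A) (?D ?A) f \<in> obj (Hom VCAT (fobj G (?D A)) (fobj G (?D ?A)))"
    if "A \<in> small_sets" "f \<in> obj (Hom VCAT (?D A) X)" for A f
    using that lift_cover(1)[OF X that] by (intro efunctor_arr[OF G]) (simp_all add: S)
  have q: "?q \<in> obj (Hom VCAT (fobj G (?D ?A)) (fobj G X))"
    by (intro efunctor_arr[OF G] discrete_in_VCAT S X cover_in)
  have leg: "N_leg VCAT (functor_comp G (DF X)) (fobj G X) ?q"
    using N_leg_efunctor[OF is_ecat_VCAT_of is_efunctor_DF[OF inf X] G X, of "cover X"]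
      is_N_colim_DF[OF inf X] by (simp add: is_N_colim_def)
  \<comment> \<open>Here f : DA -> X is read as an arrow into D(obj X), and b A supplies the passage
    from D(T A) to G(DA).\<close>
  define tr where "tr Y s A f = Comp VCAT (fobj H A) (fobj G (?D A)) Y
      (Comp VCAT (fobj G (?D A)) (fobj G (?D ?A)) Y s (farr G (?D A) (?D ?A) f)) (b A)"
    for Y and s :: "'u \<Rightarrow> 'u" and A f
  have tr_lam: "Comp VCAT (fobj H A) (fobj G X) Y h (lam X A f) =
      tr Y (Comp VCAT (fobj G (?D ?A)) (fobj G X) Y h ?q) A f"
    if Y: "Y \<in> Obj VCAT" and h: "h \<in> obj (Hom VCAT (fobj G X) Y)"
      and A: "A \<in> small_sets" and f: "f \<in> obj (Hom VCAT (?D A) X)" for Y h A f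
    unfolding tr_def lam_b[OF A f] farr_lift_cover[OF X A f]
    using A f Y S
    by (simp add: VCAT.Comp_assoc[of _ _ "fobj G X" Y] VCAT.Comp_assoc[of _ "fobj G (?D ?A)" "fobj G X" Y]
        VCAT.Comp_in O G_obj X h q b lift del: functor_comp_simps)
  have tr_cover: "s = s'" if Y: "Y \<in> Obj VCAT"
    and s: "s \<in> obj (Hom VCAT (fobj G (?D ?A)) Y)" "s' \<in> obj (Hom VCAT (fobj G (?D ?A)) Y)"
    and eq: "tr Y s ?A (cover X) = tr Y s' ?A (cover X)" for Y s s'
  proof -
    \<comment> \<open>Over D(obj X) the cover is the identity, so \<open>tr\<close> reduces to
      precomposition with b, which its inverse v undoes.\<close>
    obtain v where v: "v \<in> obj (Hom VCAT (fobj G (?D ?A)) (fobj H ?A))"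
      "Comp VCAT (fobj G (?D ?A)) (fobj H ?A) (fobj G (?D ?A)) (b ?A) v = Id VCAT (fobj G (?D ?A))"
      using b_iso[OF S] by (auto simp: is_iso_in_def simp del: functor_comp_simps)
    have id: "farr G (?D ?A) (?D ?A) (cover X) = Id VCAT (fobj G (?D ?A))"
      using efunctor_Id[OF G discrete_in_VCAT[OF S]] by (simp add: Id_discrete)
    have "Comp VCAT (fobj G (?D ?A)) (fobj H ?A) Y (tr Y t ?A (cover X)) v = t"
      if "t \<in> obj (Hom VCAT (fobj G (?D ?A)) Y)" for t
      using that Y S v
      by (simp add: tr_def id VCAT.Comp_Id VCAT.Comp_assoc[of _ "fobj H ?A" "fobj G (?D ?A)" Y] O b
          del: functor_comp_simps)
    then show ?thesis using eq s by metis
  qed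
  show ?thesis
    unfolding is_N_colim_def
  proof (intro conjI ballI allI impI G_obj X leg)
    fix Y s assume Y: "Y \<in> Obj VCAT" and s: "N_leg VCAT (functor_comp G (DF X)) Y s"
    have s_in: "s \<in> obj (Hom VCAT (fobj G (?D ?A)) Y)"
      using s by (simp add: N_leg_def)
    define \<sigma> where "\<sigma> = (\<lambda>A\<in>small_sets. \<lambda>f\<in>obj (Hom VCAT (?D A) X). tr Y s A f)"
    have \<sigma>_tr: "\<sigma> A f = tr Y s A f" if "A \<in> small_sets" "f \<in> obj (Hom VCAT (?D A) X)" for A f
      using that by (simp add: \<sigma>_def)
    have tr_in: "tr Y s A f \<in> obj (Hom VCAT (fobj H A) Y)"
      if "A \<in> small_sets" "f \<in> obj (Hom VCAT (?D A) X)" for A f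
      unfolding tr_def using that Y S
      by (intro VCAT.Comp_in[OF _ _ _ b] VCAT.Comp_in[OF _ _ _ lift] s_in O)
    have "cylinder SETv VCAT (hom_into VCAT Dfun X) H Y \<sigma>"
    proof (rule cylinderI)
      fix A f g assume "A \<in> Obj SETv" "f \<in> obj (fobj (hom_into VCAT Dfun X) A)"
        "g \<in> obj (fobj (hom_into VCAT Dfun X) A)"
      then have A: "A \<in> small_sets" and f: "f \<in> obj (Hom VCAT (?D A) X)"
        and g: "g \<in> obj (Hom VCAT (?D A) X)"
        by simp_all
      \<comment> \<open>With r the exact distance of f and g, every pair (f a, g a) lies in X_r; p
        is the induced map, and f, g are its composites with the two projections.\<close>
      define r where "r = dst (Hom VCAT (?D A) X) f g"
      let ?S = "fobj (Fdiag X) (Some r)"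
      let ?\<delta> = "\<lambda>k. farr (Fdiag X) (Some r) None k"
      define p where "p = (\<lambda>a\<in>A. pcode (f a, g a))"
      have fg: "f \<in> A \<rightarrow>\<^sub>E obj X" "g \<in> A \<rightarrow>\<^sub>E obj X"
        using f g X by (simp_all add: obj_Hom_discrete)
      have "r \<le> dst X (f a) (g a)" if "a \<in> A" for a
        unfolding r_def by (rule dst_Hom_discrete_le[OF f g that])
      then have pS: "p \<in> A \<rightarrow>\<^sub>E ?S"
        using fg by (auto simp: p_def fobj_Fdiag_Some)
      have S': "?S \<in> small_sets"
        using is_functor_Fdiag[OF inf X] by (simp add: is_functor_def)
      have p: "p \<in> obj (Hom VCAT (?D A) (?D ?S))"
        using pS by (simp add: obj_Hom_discrete S')
      have \<delta>: "?\<delta> k \<in> obj (Hom VCAT (?D ?S) (?D ?A))" if "k \<in> {Del0, Del1}" for k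
      proof -
        have "k \<in> obj (Hom (Nv :: ('v option, narr, 'v) ecat) (Some r) None)"
          using that by simp
        then show ?thesis
          using efunctor_arr[OF is_efunctor_DF[OF inf X], of "Some r" None k] by simp
      qed
      have \<delta>p: "Comp VCAT (?D A) (?D ?S) (?D ?A) (?\<delta> Del0) p = f"
        "Comp VCAT (?D A) (?D ?S) (?D ?A) (?\<delta> Del1) p = g"
        using fg pS unfolding Comp_discrete
        by (auto simp: compose_def fun_eq_iff farr_Fdiag p_def the_inv_pcode[OF inf] PiE_iff
            extensional_def split: if_splits)
      let ?s = "\<lambda>k. Comp VCAT (fobj G (?D ?S)) (fobj G (?D ?A)) Y s (farr G (?D ?S) (?D ?A) (?\<delta> k))"
      have G\<delta>: "farr G (?D ?S) (?D ?A) (?\<delta> k) \<in> obj (Hom VCAT (fobj G (?D ?S)) (fobj G (?D ?A)))"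
        if "k \<in> {Del0, Del1}" for k
        by (intro efunctor_arr[OF G] discrete_in_VCAT S S' \<delta> that)
      have Gp: "farr G (?D A) (?D ?S) p \<in> obj (Hom VCAT (fobj G (?D A)) (fobj G (?D ?S)))"
        by (intro efunctor_arr[OF G] discrete_in_VCAT A S' p)
      have s_in': "?s k \<in> obj (Hom VCAT (fobj G (?D ?S)) Y)" if "k \<in> {Del0, Del1}" for k
        by (intro VCAT.Comp_in O G\<delta> s_in S S' Y that)
      let ?t = "\<lambda>k. Comp VCAT (fobj H A) (fobj G (?D A)) Y
        (Comp VCAT (fobj G (?D A)) (fobj G (?D ?S)) Y (?s k) (farr G (?D A) (?D ?S) p)) (b A)"
      \<comment> \<open>Reassociation isolates the two arrows compared by the leg condition, so that
        their bound r passes on by precomposition with G p and with b A.\<close>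
      have tr_t: "tr Y s A (Comp VCAT (?D A) (?D ?S) (?D ?A) (?\<delta> k) p) = ?t k"
        if "k \<in> {Del0, Del1}" for k
        unfolding tr_def efunctor_Comp[OF G discrete_in_VCAT[OF A] discrete_in_VCAT[OF S']
            discrete_in_VCAT[OF S] p \<delta>[OF that]]
        by (subst VCAT.Comp_assoc[OF O(2)[OF A] O(2)[OF S'] O(2)[OF S] Y Gp G\<delta>[OF that] s_in])
          (rule refl)
      have "r \<le> dst (Hom VCAT (fobj G (?D ?S)) Y) (?s Del0) (?s Del1)"
        using s by (simp add: N_leg_def)
      also have "\<dots> \<le> dst (Hom VCAT (fobj G (?D A)) Y)
          (Comp VCAT (fobj G (?D A)) (fobj G (?D ?S)) Y (?s Del0) (farr G (?D A) (?D ?S) p))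
          (Comp VCAT (fobj G (?D A)) (fobj G (?D ?S)) Y (?s Del1) (farr G (?D A) (?D ?S) p))"
        by (intro VCAT.Comp_dst_left O A S' Y Gp s_in') simp_all
      also have "\<dots> \<le> dst (Hom VCAT (fobj H A) Y) (?t Del0) (?t Del1)"
        by (intro VCAT.Comp_dst_left VCAT.Comp_in[OF _ _ _ Gp] O A S' Y b s_in') simp_all
      also have "\<dots> = dst (Hom VCAT (fobj H A) Y) (tr Y s A f) (tr Y s A g)"
        using tr_t[of Del0] tr_t[of Del1] by (simp add: \<delta>p)
      finally show "dst (fobj (hom_into VCAT Dfun X) A) f g \<le>
          dst (Hom VCAT (fobj H A) Y) (\<sigma> A f) (\<sigma> A g)"
        using A f g by (simp add: r_def \<sigma>_tr)
    next
      fix A B k f assume "A \<in> Obj SETv" "B \<in> Obj SETv" "k \<in> obj (Hom SETv B A)"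
        "f \<in> obj (fobj (hom_into VCAT Dfun X) A)"
      then have A: "A \<in> small_sets" and B: "B \<in> small_sets" and k: "k \<in> B \<rightarrow>\<^sub>E A"
        and f: "f \<in> obj (Hom VCAT (?D A) X)"
        by simp_all
      have k': "k \<in> obj (Hom VCAT (?D B) (?D A))"
        using k by (simp add: obj_Hom_discrete A)
      have Hk: "farr H B A k \<in> obj (Hom VCAT (fobj H B) (fobj H A))"
        using F_arr[of B A k] A B k by simp
      have Gk: "farr G (?D B) (?D A) k \<in> obj (Hom VCAT (fobj G (?D B)) (fobj G (?D A)))"
        by (intro efunctor_arr[OF G] discrete_in_VCAT A B k')
      have fk: "Comp VCAT (?D B) (?D A) X f k \<in> obj (Hom VCAT (?D B) X)"
        by (intro VCAT.Comp_in discrete_in_VCAT A B X f k')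
      \<comment> \<open>The same function is needed as an arrow into X, to index \<sigma>, and as an
        arrow into D(obj X), to apply G.\<close>
      have fk_eq: "Comp VCAT (?D B) (?D A) X f k = Comp VCAT (?D B) (?D A) (?D ?A) f k"
        by (simp add: Comp_discrete)
      let ?sf = "Comp VCAT (fobj G (?D A)) (fobj G (?D ?A)) Y s (farr G (?D A) (?D ?A) f)"
      have sf: "?sf \<in> obj (Hom VCAT (fobj G (?D A)) Y)"
        by (intro VCAT.Comp_in O lift s_in S A Y f)
      have "Comp VCAT (fobj H B) (fobj H A) Y (tr Y s A f) (farr H B A k) =
          Comp VCAT (fobj H B) (fobj G (?D A)) Y ?sf
            (Comp VCAT (fobj H B) (fobj H A) (fobj G (?D A)) (b A) (farr H B A k))"
        unfolding tr_def by (intro VCAT.Comp_assoc O A B Y Hk b sf)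
      also have "\<dots> = Comp VCAT (fobj H B) (fobj G (?D B)) Y
          (Comp VCAT (fobj G (?D B)) (fobj G (?D A)) Y ?sf (farr G (?D B) (?D A) k)) (b B)"
        unfolding b_nat[OF A B k] by (intro VCAT.Comp_assoc[symmetric] O A B Y Gk b sf)
      also have "Comp VCAT (fobj G (?D B)) (fobj G (?D A)) Y ?sf (farr G (?D B) (?D A) k) =
          Comp VCAT (fobj G (?D B)) (fobj G (?D ?A)) Y s
            (farr G (?D B) (?D ?A) (Comp VCAT (?D B) (?D A) (?D ?A) f k))"
        unfolding efunctor_Comp[OF G discrete_in_VCAT[OF B] discrete_in_VCAT[OF A]
            discrete_in_VCAT[OF S] k' lift_cover(1)[OF X A f]]
        by (intro VCAT.Comp_assoc O A B S Y Gk lift f s_in)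
      finally show "Comp VCAT (fobj H B) (fobj H A) Y (\<sigma> A f) (farr H B A k) =
          \<sigma> B (farr (hom_into VCAT Dfun X) A B k f)"
        using A B f fk by (simp add: \<sigma>_tr fk_eq tr_def[of _ _ B] del: functor_comp_simps)
    next
      fix A f assume "A \<in> Obj SETv" "f \<in> obj (fobj (hom_into VCAT Dfun X) A)"
      then have *: "A \<in> small_sets" "f \<in> obj (Hom VCAT (?D A) X)"
        by simp_all
      show "\<sigma> A f \<in> obj (Hom VCAT (fobj H A) Y)"
        unfolding \<sigma>_tr[OF *] by (rule tr_in[OF *])
    qed (simp_all add: \<sigma>_def)
    then obtain h where h: "h \<in> obj (Hom VCAT (fobj G X) Y)" and h_lam: "\<And>A f. A \<in> small_sets \<Longrightarrow>
        f \<in> obj (Hom VCAT (?D A) X) \<Longrightarrow>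
        Comp VCAT (fobj H A) (fobj G X) Y h (lam X A f) = \<sigma> A f"
      using wcolim_ex[OF lam Y, of \<sigma>, unfolded free_ecat_simps(1) SET_simps(1) hom_into_simps(1)
          Dfun_simps(1)] by metis
    have hq: "Comp VCAT (fobj G (?D ?A)) (fobj G X) Y h ?q \<in> obj (Hom VCAT (fobj G (?D ?A)) Y)"
      by (intro VCAT.Comp_in O S G_obj X Y q h)
    \<comment> \<open>The arrow h is known to reproduce \<sigma>; at the cover, where
      \<open>tr\<close> determines its leg, this forces its composite with q to be s.\<close>
    have "tr Y (Comp VCAT (fobj G (?D ?A)) (fobj G X) Y h ?q) ?A (cover X) = tr Y s ?A (cover X)"
      using h_lam[of ?A "cover X"] S cover_in[OF X]
      by (simp add: tr_lam[OF Y h S cover_in[OF X], symmetric] \<sigma>_tr)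
    then have "Comp VCAT (fobj G (?D ?A)) (fobj G X) Y h ?q = s"
      by (rule tr_cover[OF Y hq s_in])
    then show "\<exists>h\<in>obj (Hom VCAT (fobj G X) Y).
        Comp VCAT (fobj (functor_comp G (DF X)) None) (fobj G X) Y h ?q = s"
      using h by auto
  next
    fix Y h h' assume Y: "Y \<in> Obj VCAT" and h: "h \<in> obj (Hom VCAT (fobj G X) Y)"
      "h' \<in> obj (Hom VCAT (fobj G X) Y)"
    let ?hq = "Comp VCAT (fobj G (?D ?A)) (fobj G X) Y h ?q"
      and ?hq' = "Comp VCAT (fobj G (?D ?A)) (fobj G X) Y h' ?q"
    show "h = h'" if "Comp VCAT (fobj (functor_comp G (DF X)) None) (fobj G X) Y h ?q =
        Comp VCAT (fobj (functor_comp G (DF X)) None) (fobj G X) Y h' ?q"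
      by (rule wcolim_uniq[OF lam Y h]) (use that in \<open>simp add: tr_lam[OF Y] h del: functor_comp_simps, simp\<close>)
    have "dst (Hom VCAT (fobj G (?D ?A)) Y) ?hq ?hq' \<le> dst (Hom VCAT (fobj G X) Y) h h'"
    proof (rule wcolim_dist[OF lam Y h])
      fix A f assume "A \<in> Obj SETv" "f \<in> obj (fobj (hom_into VCAT Dfun X) A)"
      then have A: "A \<in> small_sets" and f: "f \<in> obj (Hom VCAT (?D A) X)"
        by simp_all
      have hq: "?hq \<in> obj (Hom VCAT (fobj G (?D ?A)) Y)" "?hq' \<in> obj (Hom VCAT (fobj G (?D ?A)) Y)"
        by (intro VCAT.Comp_in O S G_obj X Y q h)+
      show "dst (Hom VCAT (fobj G (?D ?A)) Y) ?hq ?hq' \<le> dst (Hom VCAT (fobj H A) Y)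
          (Comp VCAT (fobj H A) (fobj G X) Y h (lam X A f))
          (Comp VCAT (fobj H A) (fobj G X) Y h' (lam X A f))"
        \<comment> \<open>Each component arises from the composite with q by precomposition with G f
          and then with b A, and both can only raise \<open>dst\<close>.\<close>
        unfolding tr_lam[OF Y h(1) A f] tr_lam[OF Y h(2) A f] tr_def
        by (rule order_trans[OF VCAT.Comp_dst_left[OF O(2)[OF A] O(2)[OF S] Y lift[OF A f] hq]
            VCAT.Comp_dst_left[OF O[OF A] Y b[OF A]]]) (intro VCAT.Comp_in O A S Y lift f hq)+
    qed
    then show "dst (Hom VCAT (fobj (functor_comp G (DF X)) None) Y)
        (Comp VCAT (fobj (functor_comp G (DF X)) None) (fobj G X) Y h ?q)
        (Comp VCAT (fobj (functor_comp G (DF X)) None) (fobj G X) Y h' ?q)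
        \<le> dst (Hom VCAT (fobj G X) Y) h h'"
      by simp
  qed
qed

end

end

text \<open>Infinity of the universe type makes \<open>pcode\<close> injective and keeps each X_r
  small, so that \<open>Fdiag X\<close> really is a diagram of small sets.\<close>

theorem theorem3p24:
  fixes G :: "(('u, 'v::comm_quantale) vcat, 'u \<Rightarrow> 'u, ('u, 'v) vcat, 'u \<Rightarrow> 'u) fctr"
  assumes "infinite (UNIV :: 'u set)"
    and integral: "(1::'v) = top"
    and "is_efunctor VCAT VCAT G"
  shows "(\<exists>T. is_functor SET SET T \<and>
            (\<exists>L. is_vcatification T L \<and> efunctors_iso VCAT VCAT G L))
     \<longleftrightarrow>
         ((\<forall>X\<in>Obj VCAT. preserves_wcolim Nv VCAT VCAT Nwt (functor_comp Dfun (Fdiag X)) G) \<and>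
          (\<forall>X\<in>Obj VCAT. is_discrete X \<longrightarrow> is_discrete (fobj G X)))"
    (is "?lan \<longleftrightarrow> ?pres")
proof
  assume ?lan
  then obtain T and L :: "(('u, 'v) vcat, 'u \<Rightarrow> 'u, ('u, 'v) vcat, 'u \<Rightarrow> 'u) fctr"
    where T: "is_functor SET SET T" and L: "is_vcatification T L" "efunctors_iso VCAT VCAT G L"
    by blast
  have "is_efunctor SETv (VCAT :: (('u, 'v) vcat, _, _) ecat) (functor_comp Dfun T)"
    by (rule is_efunctor_comp[OF is_efunctor_free_ecat[OF T] is_efunctor_Dfun])
  \<comment> \<open>The Kan extension structure is moved from L to G, so that the cylinders live on
    the values of G itself.\<close>
  then have "is_vcatification T G"
    using is_lan_iso[OF _ L(2) assms(3) is_ecat_VCAT_of is_ecat_VCAT_of is_efunctor_Dfun] L(1)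
    by (simp add: is_vcatification_def)
  then show ?pres
    using preserves_iff[OF assms] vcatification_N_colim[OF assms T]
      vcatification_is_discrete[OF assms T] by blast
next
  \<comment> \<open>The witnesses are \<open>restriction G\<close> for T and G itself for the Kan
    extension.\<close>
  assume ?pres
  then show ?lan
    using lan_of_preserves[OF assms] is_functor_restriction[OF assms] efunctors_iso_refl[OF assms]
    by blast
qed

end
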